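(* Consider $G\ge 2$ treatment levels with potential outcomes $Y(1),\dots,Y(G)$, assignment indicators $\mathbf{W}=(W_1,\dots,W_G)$ (each $W_g\in\{0,1\}$, $\sum_gW_g=1$) with $\rho_g=\mathbb{P}(W_g=1)>0$, and covariates $\mathbf{X}$ ($1\times K$). Assume $\mathbf{W}$ is independent of $(Y(1),\dots,Y(G),\mathbf{X})$, the data $\{(\mathbf{W}_i,Y_i(1),\dots,Y_i(G),\mathbf{X}_i)\}_{i=1}^N$ are i.i.d., and second moments are finite; observed $Y_i=\sum_g W_{ig}Y_i(g)$. Let $\hat{\boldsymbol\mu}_{SRA}=(\hat\mu_1,\dots,\hat\mu_G)'$ with $\hat\mu_g=\hat\alpha_g+\bar{\mathbf{X}}\hat{\boldsymbol\beta}_g$, where $(\hat\alpha_g,\hat{\boldsymbol\beta}_g)$ are OLS intercept and slopes from regressing $Y_i$ on $1,\mathbf{X}_i$ among units with $W_{ig}=1$ and $\bar{\mathbf{X}}=N^{-1}\sum_i\mathbf{X}_i$. Let $\hat{\boldsymbol\mu}_{PRA}$ be the vector of OLS coefficients on $\mathbf{W}_i$ in the regression of $Y_i$ on $\mathbf{W}_i,\mathbf{X}_i-\bar{\mathbf{X}}$. Then $$\mathrm{Avar}[\sqrt N(\hat{\boldsymbol\mu}_{PRA}-\boldsymbol\mu)]-\mathrm{Avar}[\sqrt N(\hat{\boldsymbol\mu}_{SRA}-\boldsymbol\mu)]=\boldsymbol\Omega_{\mathbf{F}},$$ which is positive semidefinite.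
   Context: $\mu_g=\mathbb{E}[Y(g)]$, $\boldsymbol\mu=(\mu_1,\dots,\mu_G)'$, $\dot{\mathbf{X}}=\mathbf{X}-\mathbb{E}(\mathbf{X})$, $\boldsymbol\beta_g$ is the coefficient of the population linear projection of $Y(g)-\mu_g$ onto $\dot{\mathbf{X}}$, $\boldsymbol\beta$ is the coefficient of the population linear projection of observed $Y$ onto $\dot{\mathbf{X}}$ (equal to $\sum_g\rho_g\boldsymbol\beta_g$), and $\boldsymbol\delta_g=\boldsymbol\beta_g-\boldsymbol\beta$. $\mathbf{F}_i$ is the $G\times1$ vector with $g$-th entry $\rho_g^{-1}(W_{ig}-\rho_g)\dot{\mathbf{X}}_i\boldsymbol\delta_g$ and $\boldsymbol\Omega_{\mathbf{F}}=\mathbb{E}(\mathbf{F}_i\mathbf{F}_i')$. $\mathrm{Avar}$ denotes the variance matrix of the limiting normal distribution. *)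

theory Defs
  imports "HOL-Probability.Probability"
begin

definition inv0 :: "real^'n^'n \<Rightarrow> real^'n^'n" where
  "inv0 A = (if invertible A then matrix_inv A else 0)"

definition ols :: "nat set \<Rightarrow> (nat \<Rightarrow> real^'p) \<Rightarrow> (nat \<Rightarrow> real) \<Rightarrow> real^'p" where
  "ols S r y = inv0 (\<Sum>i\<in>S. (\<chi> a b. r i $ a * r i $ b)) *v (\<Sum>i\<in>S. y i *\<^sub>R r i)"

(* assignment indicator W_g for a unit receiving treatment d *)
definition Wind :: "'g \<Rightarrow> 'g \<Rightarrow> real" where
  "Wind d g = (if d = g then 1 else 0)"

definition Xbar :: "nat \<Rightarrow> (nat \<Rightarrow> real^'k) \<Rightarrow> real^'k" where
  "Xbar n X = (1 / real n) *\<^sub>R (\<Sum>i<n. X i)"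

definition sra :: "nat \<Rightarrow> (nat \<Rightarrow> 'g) \<Rightarrow> (nat \<Rightarrow> real^'g) \<Rightarrow> (nat \<Rightarrow> real^'k::finite)
    \<Rightarrow> real^'g::finite" where
  "sra n D Y X = (\<chi> g. let c = ols {i. i < n \<and> D i = g}
        (\<lambda>i. \<chi> j. case j of None \<Rightarrow> 1 | Some k \<Rightarrow> X i $ k) (\<lambda>i. Y i $ D i)
      in c $ None + (\<Sum>k\<in>UNIV. Xbar n X $ k * c $ Some k))"

definition pra :: "nat \<Rightarrow> (nat \<Rightarrow> 'g) \<Rightarrow> (nat \<Rightarrow> real^'g) \<Rightarrow> (nat \<Rightarrow> real^'k::finite)
    \<Rightarrow> real^'g::finite" where
  "pra n D Y X = (\<chi> g. ols {..<n}
        (\<lambda>i. \<chi> j. case j of Inl h \<Rightarrow> Wind (D i) h | Inr k \<Rightarrow> X i $ k - Xbar n X $ k)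
        (\<lambda>i. Y i $ D i) $ Inl g)"

definition mu :: "'a measure \<Rightarrow> ('a \<Rightarrow> real^'g::finite) \<Rightarrow> real^'g" where
  "mu M Y0 = (\<chi> g. \<integral>\<omega>. Y0 \<omega> $ g \<partial>M)"

definition rho :: "'a measure \<Rightarrow> ('a \<Rightarrow> 'g) \<Rightarrow> 'g \<Rightarrow> real" where
  "rho M D0 g = measure M {\<omega>\<in>space M. D0 \<omega> = g}"

definition Xdot :: "'a measure \<Rightarrow> ('a \<Rightarrow> real^'k::finite) \<Rightarrow> 'a \<Rightarrow> real^'k" where
  "Xdot M X0 \<omega> = X0 \<omega> - (\<integral>\<omega>'. X0 \<omega>' \<partial>M)"

definition Sxx :: "'a measure \<Rightarrow> ('a \<Rightarrow> real^'k::finite) \<Rightarrow> real^'k^'k" where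
  "Sxx M X0 = (\<integral>\<omega>. (\<chi> a b. Xdot M X0 \<omega> $ a * Xdot M X0 \<omega> $ b) \<partial>M)"

(* coefficient of the population linear projection of Y(g) - mu_g onto Xdot *)
definition beta_g :: "'a measure \<Rightarrow> ('a \<Rightarrow> real^'g::finite) \<Rightarrow> ('a \<Rightarrow> real^'k::finite)
    \<Rightarrow> 'g \<Rightarrow> real^'k" where
  "beta_g M Y0 X0 g = inv0 (Sxx M X0) *v
     (\<integral>\<omega>. (Y0 \<omega> $ g - mu M Y0 $ g) *\<^sub>R Xdot M X0 \<omega> \<partial>M)"

(* coefficient of the population linear projection of observed Y onto Xdot *)
definition beta_obs :: "'a measure \<Rightarrow> ('a \<Rightarrow> 'g) \<Rightarrow> ('a \<Rightarrow> real^'g::finite)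
    \<Rightarrow> ('a \<Rightarrow> real^'k::finite) \<Rightarrow> real^'k" where
  "beta_obs M D0 Y0 X0 = inv0 (Sxx M X0) *v
     (\<integral>\<omega>. (Y0 \<omega> $ D0 \<omega>) *\<^sub>R Xdot M X0 \<omega> \<partial>M)"

definition delta :: "'a measure \<Rightarrow> ('a \<Rightarrow> 'g) \<Rightarrow> ('a \<Rightarrow> real^'g::finite)
    \<Rightarrow> ('a \<Rightarrow> real^'k::finite) \<Rightarrow> 'g \<Rightarrow> real^'k" where
  "delta M D0 Y0 X0 g = beta_g M Y0 X0 g - beta_obs M D0 Y0 X0"

definition Fvec :: "'a measure \<Rightarrow> ('a \<Rightarrow> 'g) \<Rightarrow> ('a \<Rightarrow> real^'g::finite)
    \<Rightarrow> ('a \<Rightarrow> real^'k::finite) \<Rightarrow> 'a \<Rightarrow> real^'g" where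
  "Fvec M D0 Y0 X0 \<omega> = (\<chi> g. (Wind (D0 \<omega>) g - rho M D0 g) / rho M D0 g
      * (Xdot M X0 \<omega> \<bullet> delta M D0 Y0 X0 g))"

definition OmegaF :: "'a measure \<Rightarrow> ('a \<Rightarrow> 'g) \<Rightarrow> ('a \<Rightarrow> real^'g::finite)
    \<Rightarrow> ('a \<Rightarrow> real^'k::finite) \<Rightarrow> real^'g^'g" where
  "OmegaF M D0 Y0 X0 = (\<integral>\<omega>. (\<chi> a b. Fvec M D0 Y0 X0 \<omega> $ a * Fvec M D0 Y0 X0 \<omega> $ b) \<partial>M)"

definition psd :: "real^'n^'n \<Rightarrow> bool" where
  "psd A \<longleftrightarrow> (\<forall>v. 0 \<le> v \<bullet> (A *v v))"

definition normal1 :: "real \<Rightarrow> real measure" where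
  "normal1 v = (if v = 0 then return borel 0 else density lborel (normal_density 0 (sqrt v)))"

definition is_mvnormal0 :: "(real^'n) measure \<Rightarrow> real^'n^'n \<Rightarrow> bool" where
  "is_mvnormal0 L V \<longleftrightarrow> sets L = sets borel \<and> prob_space L \<and> transpose V = V \<and> psd V \<and>
     (\<forall>t. distr L borel (\<lambda>x. t \<bullet> x) = normal1 (t \<bullet> (V *v t)))"

definition conv_distr :: "'a measure \<Rightarrow> (nat \<Rightarrow> 'a \<Rightarrow> 'b::topological_space) \<Rightarrow> 'b measure \<Rightarrow> bool" where
  "conv_distr M Z L \<longleftrightarrow> (\<forall>f :: 'b \<Rightarrow> real. continuous_on UNIV f \<longrightarrow> bounded (range f) \<longrightarrow>
     (\<lambda>n. \<integral>\<omega>. f (Z n \<omega>) \<partial>M) \<longlonglongrightarrow> (\<integral>x. f x \<partial>L))"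

end

theory Submission
  imports Defs
begin

text \<open>
  On an event whose probability tends to one, the normal equations show that both estimators have the form
  \<open>Ybar\<^sub>g - (Xbar\<^sub>g - Xbar) \<bullet> c\<close>, with \<open>Ybar\<^sub>g\<close>, \<open>Xbar\<^sub>g\<close> the means over the units with treatment \<open>g\<close> and \<open>c\<close> the
  estimated slope; \<open>c\<close> is consistent for \<open>beta_g g\<close> under separate and for \<open>beta_obs\<close> under pooled
  regression. As \<open>Xbar\<^sub>g - Xbar\<close> is of order \<open>1 / sqrt n\<close>, replacing \<open>c\<close> by its limit \<open>b\<close> does not
  affect the limiting distribution, and each estimator is asymptotically the average of the influence function
  \<open>W\<^sub>g (Y(g) - mu\<^sub>g) / rho\<^sub>g - (W\<^sub>g / rho\<^sub>g - 1) (Xdot \<bullet> b)\<close>. The pooled influence function is the separate one plus \<open>F\<close>,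
  and the two summands are uncorrelated because the residual of the projection of \<open>Y(g)\<close> is orthogonal to
  \<open>Xdot\<close> and the assignment is independent of \<open>(Y, X)\<close>.
\<close>

section \<open>Convergence in probability and the law of large numbers\<close>

text \<open>
  Convergence in probability is \<open>tendsto\<close> along this filter, so the whole calculus of limits applies to it.
  Exceptional sets are measurable but the event itself need not be.
\<close>

definition in_prob :: "'a measure \<Rightarrow> (nat \<times> 'a) filter" where
  "in_prob M = Abs_filter (\<lambda>P. \<forall>\<eta>>0. \<forall>\<^sub>F n in sequentially.
     \<exists>A\<in>sets M. measure M A < \<eta> \<and> (\<forall>\<omega>\<in>space M - A. P (n, \<omega>)))"

definition tight_seq :: "'a measure \<Rightarrow> (nat \<Rightarrow> 'a \<Rightarrow> 'b::real_normed_vector) \<Rightarrow> bool" where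
  "tight_seq M Z \<longleftrightarrow> (\<forall>\<eta>>0. \<exists>K. \<forall>n. \<exists>A\<in>sets M. measure M A < \<eta> \<and>
     (\<forall>\<omega>\<in>space M - A. norm (Z n \<omega>) \<le> K))"

context prob_space
begin

lemma eventually_in_prob:
  "eventually P (in_prob M) \<longleftrightarrow> (\<forall>\<eta>>0. \<forall>\<^sub>F n in sequentially.
     \<exists>A\<in>sets M. measure M A < \<eta> \<and> (\<forall>\<omega>\<in>space M - A. P (n, \<omega>)))"
  unfolding in_prob_def
proof (rule eventually_Abs_filter, rule is_filter.intro, goal_cases)
  case 1
  show ?case by (auto intro!: always_eventually bexI[of _ "{}"])
next
  case (2 P Q)
  show ?case
  proof (intro allI impI)
    fix \<eta> :: real assume "\<eta> > 0"
    then have "\<eta>/2 > 0" by simp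
    with 2 have "\<forall>\<^sub>F n in sequentially. \<exists>A\<in>sets M. measure M A < \<eta>/2 \<and> (\<forall>\<omega>\<in>space M - A. P (n, \<omega>))"
      "\<forall>\<^sub>F n in sequentially. \<exists>A\<in>sets M. measure M A < \<eta>/2 \<and> (\<forall>\<omega>\<in>space M - A. Q (n, \<omega>))"
      by blast+
    then show "\<forall>\<^sub>F n in sequentially. \<exists>A\<in>sets M. measure M A < \<eta> \<and> (\<forall>\<omega>\<in>space M - A. P (n, \<omega>) \<and> Q (n, \<omega>))"
    proof eventually_elim
      case (elim n)
      then obtain A B where AB: "A \<in> sets M" "measure M A < \<eta>/2" "\<forall>\<omega>\<in>space M - A. P (n, \<omega>)"
        "B \<in> sets M" "measure M B < \<eta>/2" "\<forall>\<omega>\<in>space M - B. Q (n, \<omega>)" by blast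
      then have "measure M (A \<union> B) < \<eta>"
        using measure_Un_le[of A M B] by simp
      with AB show ?case by (intro bexI[of _ "A \<union> B"]) auto
    qed
  qed
next
  case (3 P Q)
  show ?case
  proof (intro allI impI)
    fix \<eta> :: real assume "\<eta> > 0"
    with 3 have "\<forall>\<^sub>F n in sequentially. \<exists>A\<in>sets M. measure M A < \<eta> \<and> (\<forall>\<omega>\<in>space M - A. P (n, \<omega>))"
      by blast
    then show "\<forall>\<^sub>F n in sequentially. \<exists>A\<in>sets M. measure M A < \<eta> \<and> (\<forall>\<omega>\<in>space M - A. Q (n, \<omega>))"
      by eventually_elim (use 3 in blast)
  qed
qed

lemma eventually_in_prob_sequentially:
  assumes "\<forall>\<^sub>F n in sequentially. \<forall>\<omega>\<in>space M. P (n, \<omega>)"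
  shows "eventually P (in_prob M)"
  unfolding eventually_in_prob
  by (intro allI impI eventually_mono[OF assms]) (auto intro!: bexI[of _ "{}"])

lemma tendsto_in_prob_L1:
  fixes Z :: "nat \<Rightarrow> 'a \<Rightarrow> real"
  assumes int: "\<And>n. integrable M (Z n)"
    and lim: "(\<lambda>n. expectation (\<lambda>\<omega>. \<bar>Z n \<omega> - c\<bar>)) \<longlonglongrightarrow> 0"
  shows "((\<lambda>(n, \<omega>). Z n \<omega>) \<longlongrightarrow> c) (in_prob M)"
  unfolding tendsto_iff eventually_in_prob
proof (intro allI impI)
  fix e \<eta> :: real assume e: "e > 0" and \<eta>: "\<eta> > 0"
  have "\<forall>\<^sub>F n in sequentially. expectation (\<lambda>\<omega>. \<bar>Z n \<omega> - c\<bar>) < e * \<eta>"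
    using order_tendstoD(2)[OF lim] e \<eta> by simp
  then show "\<forall>\<^sub>F n in sequentially. \<exists>A\<in>sets M. measure M A < \<eta> \<and>
      (\<forall>\<omega>\<in>space M - A. dist (case (n, \<omega>) of (n, \<omega>) \<Rightarrow> Z n \<omega>) c < e)"
  proof eventually_elim
    case (elim n)
    have [measurable]: "Z n \<in> borel_measurable M" using int by auto
    let ?A = "{\<omega>\<in>space M. e \<le> \<bar>Z n \<omega> - c\<bar>}"
    have "measure M ?A \<le> expectation (\<lambda>\<omega>. \<bar>Z n \<omega> - c\<bar>) / e"
      by (rule integral_Markov_inequality_measure[of _ _ "{}"]) (use int e in auto)
    also have "\<dots> < \<eta>" using elim e by (simp add: field_simps)
    finally show ?case
      by (intro bexI[of _ ?A]) (auto simp: dist_real_def)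
  qed
qed

lemma tight_seqI:
  fixes Z :: "nat \<Rightarrow> 'a \<Rightarrow> 'b::euclidean_space"
  assumes [measurable]: "\<And>n. Z n \<in> borel_measurable M"
    and int: "\<And>n. integrable M (\<lambda>\<omega>. (norm (Z n \<omega>))\<^sup>2)"
    and le: "\<And>n. expectation (\<lambda>\<omega>. (norm (Z n \<omega>))\<^sup>2) \<le> C"
  shows "tight_seq M Z"
  unfolding tight_seq_def
proof (intro allI impI)
  fix \<eta> :: real assume \<eta>: "\<eta> > 0"
  define K where "K = sqrt ((\<bar>C\<bar> + 1) / \<eta>)"
  have K: "K > 0" "K\<^sup>2 = (\<bar>C\<bar> + 1) / \<eta>" using \<eta> by (auto simp: K_def)
  show "\<exists>K. \<forall>n. \<exists>A\<in>sets M. measure M A < \<eta> \<and> (\<forall>\<omega>\<in>space M - A. norm (Z n \<omega>) \<le> K)"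
  proof (intro exI[of _ K] allI)
    fix n
    let ?A = "{\<omega>\<in>space M. K\<^sup>2 \<le> (norm (Z n \<omega>))\<^sup>2}"
    have "measure M ?A \<le> expectation (\<lambda>\<omega>. (norm (Z n \<omega>))\<^sup>2) / K\<^sup>2"
      by (rule integral_Markov_inequality_measure[of _ _ "{}"]) (use int K(1) in auto)
    also have "\<dots> \<le> C / K\<^sup>2" by (intro divide_right_mono le) simp
    also have "\<dots> < \<eta>" 
    proof -
      have "C * \<eta> < (\<bar>C\<bar> + 1) * \<eta>" using \<eta> by (intro mult_strict_right_mono) auto
      then show ?thesis unfolding K(2) using \<eta> by (simp add: field_simps)
    qed
    finally show "\<exists>A\<in>sets M. measure M A < \<eta> \<and> (\<forall>\<omega>\<in>space M - A. norm (Z n \<omega>) \<le> K)"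
      using K(1) by (intro bexI[of _ ?A]) (auto simp: not_le dest: power2_less_imp_less)
  qed
qed

lemma tendsto_mult_tight:
  fixes Z :: "nat \<Rightarrow> 'a \<Rightarrow> real"
  assumes U: "(U \<longlongrightarrow> 0) (in_prob M)" and Z: "tight_seq M Z"
  shows "((\<lambda>(n, \<omega>). Z n \<omega> * U (n, \<omega>)) \<longlongrightarrow> 0) (in_prob M)"
  unfolding tendsto_iff eventually_in_prob
proof (intro allI impI)
  fix e \<eta> :: real assume e: "e > 0" and \<eta>: "\<eta> > 0"
  then obtain K where K: "\<And>n. \<exists>A\<in>sets M. measure M A < \<eta>/2 \<and> (\<forall>\<omega>\<in>space M - A. norm (Z n \<omega>) \<le> K)"
    using Z unfolding tight_seq_def by (meson half_gt_zero)
  define K' where "K' = max K 1"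
  have "eventually (\<lambda>x. dist (U x) 0 < e / K') (in_prob M)"
    using U e by (intro tendstoD) (auto simp: K'_def)
  then have "\<forall>\<^sub>F n in sequentially. \<exists>A\<in>sets M. measure M A < \<eta>/2 \<and> (\<forall>\<omega>\<in>space M - A. dist (U (n, \<omega>)) 0 < e / K')"
    using \<eta> unfolding eventually_in_prob by (meson half_gt_zero)
  then show "\<forall>\<^sub>F n in sequentially. \<exists>A\<in>sets M. measure M A < \<eta> \<and>
      (\<forall>\<omega>\<in>space M - A. dist (case (n, \<omega>) of (n, \<omega>) \<Rightarrow> Z n \<omega> * U (n, \<omega>)) 0 < e)"
  proof eventually_elim
    case (elim n)
    then obtain A where A: "A \<in> sets M" "measure M A < \<eta>/2" "\<And>\<omega>. \<omega>\<in>space M - A \<Longrightarrow> dist (U (n, \<omega>)) 0 < e / K'"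
      by blast
    obtain B where B: "B \<in> sets M" "measure M B < \<eta>/2" "\<And>\<omega>. \<omega>\<in>space M - B \<Longrightarrow> norm (Z n \<omega>) \<le> K"
      using K by blast
    have "\<bar>Z n \<omega>\<bar> * \<bar>U (n, \<omega>)\<bar> < e" if "\<omega> \<in> space M - (A \<union> B)" for \<omega>
    proof -
      have "\<bar>Z n \<omega>\<bar> * \<bar>U (n, \<omega>)\<bar> \<le> K' * \<bar>U (n, \<omega>)\<bar>"
        using B(3)[of \<omega>] that by (intro mult_right_mono) (auto simp: K'_def)
      also have "\<dots> < e" using A(3)[of \<omega>] that by (simp add: K'_def field_simps)
      finally show ?thesis .
    qed
    moreover have "measure M (A \<union> B) < \<eta>"
      using measure_Un_le[of A M B] A B by simp
    ultimately show ?case using A(1) B(1)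
      by (intro bexI[of _ "A \<union> B"]) (auto simp: abs_mult)
  qed
qed

lemma abs_expectation_le:
  fixes u :: "'a \<Rightarrow> real"
  assumes [measurable]: "u \<in> borel_measurable M" "A \<in> sets M"
    and C: "\<And>\<omega>. \<bar>u \<omega>\<bar> \<le> C" and e: "e \<ge> 0" "\<And>\<omega>. \<omega> \<in> space M - A \<Longrightarrow> \<bar>u \<omega>\<bar> \<le> e"
  shows "\<bar>expectation u\<bar> \<le> e + C * measure M A"
proof -
  have "\<bar>expectation u\<bar> \<le> expectation (\<lambda>\<omega>. \<bar>u \<omega>\<bar>)"
    by (rule integral_abs_bound)
  also have "\<dots> \<le> expectation (\<lambda>\<omega>. e + C * indicator A \<omega>)"
  proof (rule integral_mono)
    show "integrable M (\<lambda>\<omega>. \<bar>u \<omega>\<bar>)" using C by (intro integrable_const_bound[of _ C]) auto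
    show "integrable M (\<lambda>\<omega>. e + C * indicator A \<omega> :: real)"
      by (intro Bochner_Integration.integrable_add integrable_const integrable_mult_right integrable_real_indicator) (auto simp: less_top[symmetric])
    show "\<bar>u \<omega>\<bar> \<le> e + C * indicator A \<omega>" if "\<omega> \<in> space M" for \<omega>
      using e(2)[of \<omega>] C[of \<omega>] e(1) that by (auto simp: indicator_def)
  qed
  also have "\<dots> = e + C * measure M A"
    by (subst Bochner_Integration.integral_add) (auto simp: prob_space less_top[symmetric])
  finally show ?thesis .
qed

lemma expectation_tendsto_0_in_prob:
  fixes h :: "nat \<Rightarrow> 'a \<Rightarrow> real"
  assumes h: "((\<lambda>(n, \<omega>). h n \<omega>) \<longlongrightarrow> 0) (in_prob M)"
    and [measurable]: "\<And>n. h n \<in> borel_measurable M"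
    and bd: "\<And>n \<omega>. \<bar>h n \<omega>\<bar> \<le> B"
  shows "(\<lambda>n. expectation (h n)) \<longlonglongrightarrow> 0"
  unfolding tendsto_iff
proof (intro allI impI)
  fix e :: real assume e: "e > 0"
  define C where "C = \<bar>B\<bar> + 1"
  have "B \<le> C" "C > 0" by (auto simp: C_def)
  with bd have C: "C > 0" "\<And>n \<omega>. \<bar>h n \<omega>\<bar> \<le> C" by (blast intro: order_trans)+
  have "e / (2 * C) > 0" using e C by simp
  moreover have "eventually (\<lambda>x. dist (case x of (n, \<omega>) \<Rightarrow> h n \<omega>) 0 < e / 2) (in_prob M)"
    using e by (intro tendstoD[OF h]) auto
  ultimately have "\<forall>\<^sub>F n in sequentially. \<exists>A\<in>sets M. measure M A < e / (2*C) \<and> (\<forall>\<omega>\<in>space M - A. \<bar>h n \<omega>\<bar> < e / 2)"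
    unfolding eventually_in_prob by simp
  then show "\<forall>\<^sub>F n in sequentially. dist (expectation (h n)) 0 < e"
  proof eventually_elim
    case (elim n)
    then obtain A where A[measurable]: "A \<in> sets M" and A': "measure M A < e / (2*C)" "\<And>\<omega>. \<omega>\<in>space M - A \<Longrightarrow> \<bar>h n \<omega>\<bar> < e / 2"
      by blast
    have "\<bar>expectation (h n)\<bar> \<le> e/2 + C * measure M A"
      using A'(2) C e by (intro abs_expectation_le) (auto intro: less_imp_le)
    also have "\<dots> < e" using A'(1) C(1) by (simp add: field_simps)
    finally show ?case by simp
  qed
qed

lemma second_moment_sum:
  fixes Z :: "nat \<Rightarrow> 'a \<Rightarrow> real"
  assumes ind: "indep_vars (\<lambda>_. borel) Z UNIV"
    and sq: "\<And>i. integrable M (\<lambda>\<omega>. (Z i \<omega>)\<^sup>2)"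
    and zero: "\<And>i. expectation (Z i) = 0"
    and v: "\<And>i. expectation (\<lambda>\<omega>. (Z i \<omega>)\<^sup>2) = v"
  shows "integrable M (\<lambda>\<omega>. (\<Sum>i<n. Z i \<omega>)\<^sup>2) \<and> expectation (\<lambda>\<omega>. (\<Sum>i<n. Z i \<omega>)\<^sup>2) = real n * v"
proof (induction n)
  case 0
  show ?case by simp
next
  case (Suc n)
  have [measurable]: "\<And>i. Z i \<in> borel_measurable M"
    using ind by (auto simp: indep_vars_def)
  have int: "\<And>i. integrable M (Z i)"
    by (rule square_integrable_imp_integrable[OF _ sq]) auto
  let ?S = "\<lambda>\<omega>. \<Sum>i<n. Z i \<omega>"
  have intS: "integrable M ?S" using int by auto
  have iv: "indep_var borel (Z n) borel ?S"
    by (rule indep_vars_sum[OF _ _ indep_vars_subset[OF ind]]) auto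
  have 1: "expectation (\<lambda>\<omega>. Z n \<omega> * ?S \<omega>) = 0" "integrable M (\<lambda>\<omega>. Z n \<omega> * ?S \<omega>)"
    using indep_var_lebesgue_integral[OF iv int intS] indep_var_integrable[OF iv int intS] zero by auto
  have eq: "(\<lambda>\<omega>. (\<Sum>i<Suc n. Z i \<omega>)\<^sup>2) = (\<lambda>\<omega>. (?S \<omega>)\<^sup>2 + (2 * (Z n \<omega> * ?S \<omega>) + (Z n \<omega>)\<^sup>2))"
    by (auto simp: power2_sum algebra_simps)
  show ?case
    unfolding eq using Suc 1 sq[of n] v[of n]
    by (auto simp: algebra_simps)
qed

lemma weak_law_of_large_numbers:
  fixes Z :: "nat \<Rightarrow> 'a \<Rightarrow> real"
  assumes ind: "indep_vars (\<lambda>_. borel) Z UNIV"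
    and id: "\<And>i. distr M borel (Z i) = distr M borel (Z 0)"
    and int0: "integrable M (Z 0)"
  shows "((\<lambda>(n, \<omega>). (\<Sum>i<n. Z i \<omega>) / real n) \<longlongrightarrow> expectation (Z 0)) (in_prob M)"
proof (rule tendsto_in_prob_L1)
  have [measurable]: "\<And>i. Z i \<in> borel_measurable M"
    using ind by (auto simp: indep_vars_def)
  have transfer: "expectation (\<lambda>\<omega>. f (Z i \<omega>)) = expectation (\<lambda>\<omega>. f (Z 0 \<omega>))"
    "integrable M (\<lambda>\<omega>. f (Z i \<omega>)) \<longleftrightarrow> integrable M (\<lambda>\<omega>. f (Z 0 \<omega>))"
    if [measurable]: "f \<in> borel_measurable borel" for f :: "real \<Rightarrow> real" and i
    using integral_distr[of "Z i" M borel f] integral_distr[of "Z 0" M borel f]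
      integrable_distr_eq[of "Z i" M borel f] integrable_distr_eq[of "Z 0" M borel f] id[of i] by auto
  have int: "\<And>i. integrable M (Z i)" using transfer(2)[of "\<lambda>x. x"] int0 by simp
  then show intm: "\<And>n. integrable M (\<lambda>\<omega>. (\<Sum>i<n. Z i \<omega>) / real n)" by auto
  define m where "m = expectation (Z 0)"
  define cl where "cl = (\<lambda>C (x::real). max (-real C) (min (real C) x))"
  have [measurable]: "\<And>C. cl C \<in> borel_measurable borel" unfolding cl_def by measurable
  have clbd: "\<bar>cl C x\<bar> \<le> real C" "\<bar>x - cl C x\<bar> \<le> \<bar>x\<bar>" for C x by (auto simp: cl_def)
  have "(\<lambda>C. expectation (\<lambda>\<omega>. \<bar>Z 0 \<omega> - cl C (Z 0 \<omega>)\<bar>)) \<longlonglongrightarrow> expectation (\<lambda>\<omega>. 0)"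
  proof (rule integral_dominated_convergence[where w = "\<lambda>\<omega>. \<bar>Z 0 \<omega>\<bar>"])
    show "AE \<omega> in M. (\<lambda>C. \<bar>Z 0 \<omega> - cl C (Z 0 \<omega>)\<bar>) \<longlonglongrightarrow> 0"
    proof (rule AE_I2, rule tendsto_eventually)
      fix \<omega>
      show "\<forall>\<^sub>F C in sequentially. \<bar>Z 0 \<omega> - cl C (Z 0 \<omega>)\<bar> = 0"
        using eventually_ge_at_top[of "nat \<lceil>\<bar>Z 0 \<omega>\<bar>\<rceil>"]
        by eventually_elim (auto simp: cl_def max_def min_def; linarith)
    qed
  qed (use int0 clbd in \<open>auto simp del: abs_le_iff\<close>)
  then have trunc: "(\<lambda>C. expectation (\<lambda>\<omega>. \<bar>Z 0 \<omega> - cl C (Z 0 \<omega>)\<bar>)) \<longlonglongrightarrow> 0" by simp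
  show "(\<lambda>n. expectation (\<lambda>\<omega>. \<bar>(\<Sum>i<n. Z i \<omega>) / real n - expectation (Z 0)\<bar>)) \<longlonglongrightarrow> 0"
    unfolding m_def[symmetric] tendsto_iff
  proof (intro allI impI)
    fix e :: real assume e: "e > 0"
    obtain C where C: "expectation (\<lambda>\<omega>. \<bar>Z 0 \<omega> - cl C (Z 0 \<omega>)\<bar>) < e / 4"
      using order_tendstoD(2)[OF trunc, of "e/4"] e by (auto dest: eventually_happens)
    define mc where "mc = expectation (\<lambda>\<omega>. cl C (Z 0 \<omega>))"
    define V where "V = (\<lambda>i \<omega>. cl C (Z i \<omega>) - mc)"
    define v where "v = expectation (\<lambda>\<omega>. (V 0 \<omega>)\<^sup>2)"
    have [measurable]: "\<And>i. V i \<in> borel_measurable M" unfolding V_def by measurable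
    have intcl: "integrable M (\<lambda>\<omega>. cl C (Z i \<omega>))" for i
      using clbd by (intro integrable_const_bound[of _ "real C"]) auto
    have Vbd: "\<bar>V i \<omega>\<bar> \<le> real C + \<bar>mc\<bar>" for i \<omega>
      unfolding V_def using clbd(1)[of C "Z i \<omega>"] by linarith
    have sqV: "integrable M (\<lambda>\<omega>. (V i \<omega>)\<^sup>2)" for i
      using Vbd by (intro integrable_const_bound[of _ "(real C + \<bar>mc\<bar>)\<^sup>2"]) (auto intro!: AE_I2 power2_le_iff_abs_le[THEN iffD2])
    have indV: "indep_vars (\<lambda>_. borel) V UNIV"
      unfolding V_def by (rule indep_vars_compose2[OF ind, where Y="\<lambda>_ x. cl C x - mc"]) measurable
    have zV: "expectation (V i) = 0" for i
      unfolding V_def using intcl transfer(1)[of "cl C" i] by (simp add: mc_def prob_space)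
    have vV: "expectation (\<lambda>\<omega>. (V i \<omega>)\<^sup>2) = v" for i
      unfolding v_def V_def using transfer(1)[of "\<lambda>x. (cl C x - mc)\<^sup>2" i] by simp
    note S2 = second_moment_sum[OF indV sqV zV vV]
    have bound: "expectation (\<lambda>\<omega>. \<bar>(\<Sum>i<n. Z i \<omega>) / real n - m\<bar>) \<le> 3 * e / 4 + v / (e * real n)"
      if n: "n > 0" for n
    proof -
      let ?R = "\<lambda>\<omega>. (\<Sum>i<n. \<bar>Z i \<omega> - cl C (Z i \<omega>)\<bar>) / real n"
      let ?S = "\<lambda>\<omega>. (\<Sum>i<n. V i \<omega>)"
      have "expectation (\<lambda>\<omega>. \<bar>(\<Sum>i<n. Z i \<omega>) / real n - m\<bar>)
        \<le> expectation (\<lambda>\<omega>. ?R \<omega> + ((e / 4 + (?S \<omega>)\<^sup>2 / (e * (real n)\<^sup>2)) + e / 4))"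
      proof (rule integral_mono)
        show "integrable M (\<lambda>\<omega>. \<bar>(\<Sum>i<n. Z i \<omega>) / real n - m\<bar>)" using intm[of n] by auto
        show "integrable M (\<lambda>\<omega>. ?R \<omega> + ((e / 4 + (?S \<omega>)\<^sup>2 / (e * (real n)\<^sup>2)) + e / 4))"
          using int intcl S2 by auto
        fix \<omega>
        have "(\<Sum>i<n. Z i \<omega>) / real n - m = (\<Sum>i<n. Z i \<omega> - cl C (Z i \<omega>)) / real n + ?S \<omega> / real n + (mc - m)"
          using n by (simp add: V_def sum_subtractf field_simps)
        moreover have "\<bar>(\<Sum>i<n. Z i \<omega> - cl C (Z i \<omega>)) / real n\<bar> \<le> ?R \<omega>"
          by (auto simp: abs_divide intro!: divide_right_mono)
        moreover have "\<bar>mc - m\<bar> \<le> e / 4"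
        proof -
          have "\<bar>m - mc\<bar> = \<bar>expectation (\<lambda>\<omega>. Z 0 \<omega> - cl C (Z 0 \<omega>))\<bar>"
            using int intcl by (simp add: m_def mc_def)
          also have "\<dots> \<le> expectation (\<lambda>\<omega>. \<bar>Z 0 \<omega> - cl C (Z 0 \<omega>)\<bar>)" by (rule integral_abs_bound)
          finally show ?thesis using C by linarith
        qed
        moreover have "\<bar>?S \<omega> / real n\<bar> \<le> e / 4 + (?S \<omega>)\<^sup>2 / (e * (real n)\<^sup>2)"
        proof -
          let ?s = "\<bar>?S \<omega> / real n\<bar>"
          have "0 \<le> (?s - e/2)\<^sup>2 / e" using e by simp
          also have "\<dots> = ?s\<^sup>2 / e - ?s + e / 4" using e by (simp add: power2_diff field_simps) (simp add: power2_eq_square)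
          also have "?s\<^sup>2 / e = (?S \<omega>)\<^sup>2 / (e * (real n)\<^sup>2)" by (simp add: power_divide field_simps)
          finally show ?thesis by linarith
        qed
        ultimately show "\<bar>(\<Sum>i<n. Z i \<omega>) / real n - m\<bar> \<le> ?R \<omega> + ((e / 4 + (?S \<omega>)\<^sup>2 / (e * (real n)\<^sup>2)) + e / 4)"
          by linarith
      qed
      also have "\<dots> = expectation ?R + ((e/4 + expectation (\<lambda>\<omega>. (?S \<omega>)\<^sup>2) / (e * (real n)\<^sup>2)) + e / 4)"
        using int intcl S2[of n] by (simp add: prob_space)
      also have "expectation ?R = expectation (\<lambda>\<omega>. \<bar>Z 0 \<omega> - cl C (Z 0 \<omega>)\<bar>)"
      proof -
        have "expectation ?R = (\<Sum>i<n. expectation (\<lambda>\<omega>. \<bar>Z i \<omega> - cl C (Z i \<omega>)\<bar>)) / real n"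
          using int intcl by simp
        also have "\<dots> = (\<Sum>i<n. expectation (\<lambda>\<omega>. \<bar>Z 0 \<omega> - cl C (Z 0 \<omega>)\<bar>)) / real n"
          by (intro arg_cong[where f="\<lambda>x. x / real n"] sum.cong refl transfer(1)[of "\<lambda>x. \<bar>x - cl C x\<bar>"]) measurable
        finally show ?thesis using n by simp
      qed
      also have "expectation (\<lambda>\<omega>. (?S \<omega>)\<^sup>2) / (e * (real n)\<^sup>2) = v / (e * real n)"
        using S2[of n] n e by (simp add: power2_eq_square)
      finally show ?thesis using C by simp
    qed
    have "(\<lambda>n. v / e * inverse (real n)) \<longlonglongrightarrow> v / e * 0"
      by (intro tendsto_intros lim_inverse_n)
    then have "\<forall>\<^sub>F n in sequentially. v / e * inverse (real n) < e / 4"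
      by (rule order_tendstoD(2)) (use e in simp)
    then show "\<forall>\<^sub>F n in sequentially. dist (expectation (\<lambda>\<omega>. \<bar>(\<Sum>i<n. Z i \<omega>) / real n - m\<bar>)) 0 < e"
      using eventually_gt_at_top[of 0]
    proof eventually_elim
      case (elim n)
      have "v / e * inverse (real n) = v / (e * real n)" by (simp add: field_simps)
      moreover have "0 \<le> expectation (\<lambda>\<omega>. \<bar>(\<Sum>i<n. Z i \<omega>) / real n - m\<bar>)"
        by simp
      ultimately have "\<bar>expectation (\<lambda>\<omega>. \<bar>(\<Sum>i<n. Z i \<omega>) / real n - m\<bar>)\<bar> < e"
        using bound[OF elim(2)] elim(1) by linarith
      then show ?case by simp
    qed
  qed
qed

end

section \<open>Centered Gaussian vectors\<close>

definition outer :: "real^'n \<Rightarrow> real^'n^'n" where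
  "outer w = (\<chi> a b. w $ a * w $ b)"

lemma outer_mult_vec: "outer w *v x = (w \<bullet> x) *\<^sub>R w"
  by (simp add: outer_def matrix_vector_mult_def vec_eq_iff inner_vec_def sum_distrib_left mult_ac)

lemma transpose_outer: "transpose (outer w) = outer w"
  by (simp add: outer_def transpose_def vec_eq_iff mult.commute)

lemma symmetric_matrix_inner:
  fixes V :: "real^'n^'n"
  assumes "transpose V = V"
  shows "x \<bullet> (V *v y) = (V *v x) \<bullet> y"
  using dot_lmul_matrix[of x V y] assms by (metis vector_transpose_matrix)

lemma psd_Cauchy_Schwarz:
  fixes V :: "real^'n^'n"
  assumes sym: "transpose V = V" and psd: "psd V" and q: "u \<bullet> (V *v u) > 0"
  shows "((V *v u) \<bullet> x)\<^sup>2 \<le> (u \<bullet> (V *v u)) * (x \<bullet> (V *v x))"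
proof -
  define q where "q = u \<bullet> (V *v u)"
  define p where "p = (V *v u) \<bullet> x"
  let ?y = "q *\<^sub>R x - p *\<^sub>R u"
  have p': "u \<bullet> (V *v x) = p" "x \<bullet> (V *v u) = p"
    using symmetric_matrix_inner[OF sym, of u x] by (auto simp: p_def inner_commute)
  have "0 \<le> ?y \<bullet> (V *v ?y)" using psd by (simp add: psd_def)
  also have "\<dots> = q * (q * (x \<bullet> (V *v x)) - p\<^sup>2)"
    by (simp add: matrix_vector_mult_diff_distrib matrix_vector_mult_scaleR inner_diff_left inner_diff_right
        p' q_def[symmetric] power2_eq_square algebra_simps)
  finally show ?thesis using q by (simp add: q_def p_def zero_le_mult_iff)
qed

text \<open>
  Peeling off the rank-one part \<open>(V u) (V u)\<^sup>T / (u \<bullet> V u)\<close> of \<open>V\<close> leaves a positive semidefinite matrix with a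
  larger kernel and corresponds to adding an independent one-dimensional normal variable.
\<close>

lemma exists_gaussian_char:
  fixes V :: "real^'n^'n"
  assumes "transpose V = V" "psd V"
  shows "\<exists>L. sets L = sets borel \<and> prob_space L \<and>
    (\<forall>t. (CLINT x|L. iexp (t \<bullet> x)) = complex_of_real (exp (- (t \<bullet> (V *v t)) / 2)))"
  using assms
proof (induction "CARD('n) - dim {x. V *v x = 0}" arbitrary: V rule: less_induct)
  case less
  show ?case
  proof (cases "\<forall>u. u \<bullet> (V *v u) = 0")
    case True
    show ?thesis
      by (rule exI[of _ "return borel 0"]) (use True in \<open>auto simp: prob_space_return integral_return\<close>)
  next
    case False
    then obtain u where u: "u \<bullet> (V *v u) > 0"
      using less.prems(2) unfolding psd_def by (metis order_le_less)
    define q where "q = u \<bullet> (V *v u)"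
    define w where "w = (1 / sqrt q) *\<^sub>R (V *v u)"
    define V' where "V' = V - outer w"
    have q: "q > 0" "sqrt q * sqrt q = q" using u by (auto simp: q_def)
    have V'v: "V' *v x = V *v x - (w \<bullet> x) *\<^sub>R w" for x
      by (simp add: V'_def matrix_vector_mult_diff_rdistrib outer_mult_vec)
    have sym': "transpose V' = V'"
      using less.prems(1) transpose_outer[of w] by (simp add: V'_def transpose_def vec_eq_iff)
    have wx: "w \<bullet> x = ((V *v u) \<bullet> x) / sqrt q" for x by (simp add: w_def)
    have wx2: "(w \<bullet> x)\<^sup>2 = ((V *v u) \<bullet> x)\<^sup>2 / q" for x
      using q by (simp add: wx power_divide)
    have quad: "x \<bullet> (V' *v x) = x \<bullet> (V *v x) - (w \<bullet> x)\<^sup>2" for x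
      by (simp add: V'v inner_diff_right power2_eq_square inner_commute)
    have psd': "psd V'"
      unfolding psd_def quad wx2
      using psd_Cauchy_Schwarz[OF less.prems u] q by (simp add: q_def field_simps)
    have "dim {x. V *v x = 0} < dim {x. V' *v x = 0}"
    proof (rule dim_psubset)
      have sub: "subspace {x. A *v x = 0}" for A :: "real^'n^'n"
        by (auto simp: subspace_def matrix_vector_right_distrib matrix_vector_mult_scaleR)
      have "V' *v x = 0" if "V *v x = 0" for x
        using that symmetric_matrix_inner[OF less.prems(1), of u x] by (simp add: V'v wx)
      moreover have "(V *v u) \<bullet> u = q" by (simp add: q_def inner_commute)
      then have "V' *v u = 0" using q by (simp add: V'v wx w_def)
      moreover have "V *v u \<noteq> 0" using u by auto
      ultimately have "{x. V *v x = 0} \<subset> {x. V' *v x = 0}" by auto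
      then show "span {x. V *v x = 0} \<subset> span {x. V' *v x = 0}"
        using sub by (simp add: span_eq_iff[THEN iffD2])
    qed
    moreover have "dim {x. V' *v x = 0} \<le> CARD('n)"
      using dim_subset_UNIV[of "{x. V' *v x = 0}"] by simp
    ultimately have "CARD('n) - dim {x. V' *v x = 0} < CARD('n) - dim {x. V *v x = 0}" by linarith
    from less.hyps[OF this sym' psd'] obtain L' where L': "sets L' = sets borel" "prob_space L'"
      "\<And>t. (CLINT x|L'. iexp (t \<bullet> x)) = complex_of_real (exp (- (t \<bullet> (V' *v t)) / 2))" by blast
    let ?N = "std_normal_distribution"
    interpret L': prob_space L' by fact
    interpret N: real_distribution ?N by (rule real_dist_normal_dist)
    interpret P: pair_prob_space L' ?N ..
    note [measurable_cong] = L'(1)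
    have [measurable]: "(\<lambda>(x, s). x + s *\<^sub>R w) \<in> (L' \<Otimes>\<^sub>M ?N) \<rightarrow>\<^sub>M borel" by measurable
    let ?L = "distr (L' \<Otimes>\<^sub>M ?N) borel (\<lambda>(x, s). x + s *\<^sub>R w)"
    have "(CLINT x|?L. iexp (t \<bullet> x)) = complex_of_real (exp (- (t \<bullet> (V *v t)) / 2))" for t
    proof -
      have "(CLINT x|?L. iexp (t \<bullet> x)) = (CLINT p|(L' \<Otimes>\<^sub>M ?N). iexp (t \<bullet> (case p of (x, s) \<Rightarrow> x + s *\<^sub>R w)))"
        by (subst integral_distr) auto
      also have "\<dots> = (CLINT p|(L' \<Otimes>\<^sub>M ?N). (case p of (x, s) \<Rightarrow> iexp (t \<bullet> x) * iexp ((t \<bullet> w) * s)))"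
        by (intro Bochner_Integration.integral_cong) (auto simp: inner_add_right exp_add[symmetric] algebra_simps)
      also have "\<dots> = (CLINT x|L'. (CLINT s|?N. iexp (t \<bullet> x) * iexp ((t \<bullet> w) * s)))"
        by (subst P.integral_fst) (auto intro!: P.P.integrable_const_bound[of _ 1] simp: norm_mult)
      also have "\<dots> = (CLINT x|L'. iexp (t \<bullet> x)) * char ?N (t \<bullet> w)"
        by (simp add: char_def)
      also have "\<dots> = complex_of_real (exp (- (t \<bullet> (V *v t)) / 2))"
        unfolding L'(3) char_std_normal_distribution quad
        by (simp add: inner_commute[of t w] exp_add[symmetric] flip: of_real_mult) (simp add: field_simps)
      finally show ?thesis .
    qed
    moreover have "prob_space ?L" by (rule P.P.prob_space_distr) simp
    ultimately show ?thesis by (intro exI[of _ ?L]) auto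
  qed
qed

lemma real_distribution_normal1: "v \<ge> 0 \<Longrightarrow> real_distribution (normal1 v)"
  by (auto simp: normal1_def real_distribution_def real_distribution_axioms_def prob_space_return
      intro!: prob_space_normal_density)

lemma char_normal1:
  assumes "v \<ge> 0"
  shows "char (normal1 v) s = complex_of_real (exp (- (v * s\<^sup>2) / 2))"
proof (cases "v = 0")
  case True
  then show ?thesis by (simp add: normal1_def char_def integral_return)
next
  case False
  interpret N: real_distribution std_normal_distribution by (rule real_dist_normal_dist)
  have "distributed std_normal_distribution lborel (\<lambda>x. 0 + sqrt v * x)
      (\<lambda>x. ennreal (normal_density (0 + sqrt v * 0) (\<bar>sqrt v\<bar> * 1) x))"
    by (rule N.normal_density_affine) (use False assms in \<open>auto simp: distributed_def distr_id2\<close>)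
  then have "normal1 v = distr std_normal_distribution lborel (\<lambda>x. sqrt v * x)"
    using False assms by (simp add: distributed_def normal1_def)
  then have "char (normal1 v) s = char std_normal_distribution (s * sqrt v)"
    unfolding char_def by (simp add: integral_distr mult_ac)
  then show ?thesis
    using assms by (simp add: char_std_normal_distribution power_mult_distrib mult.commute)
qed

lemma exists_mvnormal0:
  fixes V :: "real^'n^'n"
  assumes sym: "transpose V = V" and psd: "psd V"
  obtains L where "is_mvnormal0 L V"
    "\<And>t. (CLINT x|L. iexp (t \<bullet> x)) = complex_of_real (exp (- (t \<bullet> (V *v t)) / 2))"
proof -
  obtain L where L: "sets L = sets borel" "prob_space L"
    "\<And>t. (CLINT x|L. iexp (t \<bullet> x)) = complex_of_real (exp (- (t \<bullet> (V *v t)) / 2))"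
    using exists_gaussian_char[OF assms] by blast
  interpret L: prob_space L by fact
  note [measurable_cong] = L(1)
  have "distr L borel (\<lambda>x. t \<bullet> x) = normal1 (t \<bullet> (V *v t))" for t
  proof (rule Levy_uniqueness)
    have v: "0 \<le> t \<bullet> (V *v t)" using psd by (simp add: psd_def)
    show "real_distribution (distr L borel (\<lambda>x. t \<bullet> x))"
      by (auto simp: real_distribution_def real_distribution_axioms_def intro!: L.prob_space_distr)
    show "real_distribution (normal1 (t \<bullet> (V *v t)))" by (rule real_distribution_normal1[OF v])
    show "char (distr L borel (\<lambda>x. t \<bullet> x)) = char (normal1 (t \<bullet> (V *v t)))"
    proof
      fix s
      have "char (distr L borel (\<lambda>x. t \<bullet> x)) s = (CLINT x|L. iexp ((s *\<^sub>R t) \<bullet> x))"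
        by (simp add: char_def integral_distr)
      also have "\<dots> = char (normal1 (t \<bullet> (V *v t))) s"
        unfolding L(3) char_normal1[OF v]
        by (simp add: matrix_vector_mult_scaleR power2_eq_square mult_ac)
      finally show "char (distr L borel (\<lambda>x. t \<bullet> x)) s = char (normal1 (t \<bullet> (V *v t))) s" .
    qed
  qed
  with L sym psd have "is_mvnormal0 L V" by (simp add: is_mvnormal0_def)
  with L(3) that show ?thesis by blast
qed

section \<open>The multivariate central limit theorem\<close>

inductive trig_poly :: "(real^'n \<Rightarrow> real) \<Rightarrow> bool" where
  cos: "trig_poly (\<lambda>x. a * cos (t \<bullet> x + c))"
| add: "trig_poly f \<Longrightarrow> trig_poly g \<Longrightarrow> trig_poly (\<lambda>x. f x + g x)"

lemma trig_poly_const: "trig_poly (\<lambda>x. c)"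
  using trig_poly.cos[of c 0 0] by simp

lemma trig_poly_mult:
  assumes "trig_poly f" "trig_poly g"
  shows "trig_poly (\<lambda>x. f x * g x)"
  using assms(1)
proof induction
  case (cos a t c)
  show ?case using assms(2)
  proof induction
    case (cos b s d)
    have "(\<lambda>x. a * cos (t \<bullet> x + c) * (b * cos (s \<bullet> x + d))) =
      (\<lambda>x. (a * b / 2) * cos ((t - s) \<bullet> x + (c - d)) + (a * b / 2) * cos ((t + s) \<bullet> x + (c + d)))"
    proof
      fix x
      have "cos (t \<bullet> x + c) * cos (s \<bullet> x + d) =
        (cos ((t - s) \<bullet> x + (c - d)) + cos ((t + s) \<bullet> x + (c + d))) / 2"
        by (subst cos_times_cos) (simp add: inner_diff_left inner_add_left algebra_simps)
      then have "(a * b) * (cos (t \<bullet> x + c) * cos (s \<bullet> x + d)) =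
        (a * b) * ((cos ((t - s) \<bullet> x + (c - d)) + cos ((t + s) \<bullet> x + (c + d))) / 2)"
        by (rule arg_cong)
      then show "a * cos (t \<bullet> x + c) * (b * cos (s \<bullet> x + d)) =
        (a * b / 2) * cos ((t - s) \<bullet> x + (c - d)) + (a * b / 2) * cos ((t + s) \<bullet> x + (c + d))"
        by argo
    qed
    then show ?case by (simp only:) (intro trig_poly.intros)
  next
    case (add f g)
    then show ?case by (simp add: distrib_left trig_poly.add)
  qed
next
  case (add f g)
  then show ?case by (simp add: distrib_right trig_poly.add)
qed

lemma trig_poly_sum: "(\<And>i. i \<in> I \<Longrightarrow> trig_poly (f i)) \<Longrightarrow> trig_poly (\<lambda>x. \<Sum>i\<in>I. f i x)"
  by (induction I rule: infinite_finite_induct) (auto intro: trig_poly_const trig_poly.add)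

lemma trig_poly_continuous: "trig_poly f \<Longrightarrow> continuous_on UNIV f"
  by (induction rule: trig_poly.induct) (intro continuous_intros)+

lemma trig_poly_bounded: "trig_poly f \<Longrightarrow> \<exists>B. \<forall>x. \<bar>f x\<bar> \<le> B"
proof (induction rule: trig_poly.induct)
  case (cos a t c)
  show ?case by (rule exI[of _ "\<bar>a\<bar>"]) (simp add: abs_mult mult_left_le)
next
  case (add f g)
  then obtain B C where "\<forall>x. \<bar>f x\<bar> \<le> B" "\<forall>x. \<bar>g x\<bar> \<le> C" by blast
  then show ?case
    by (intro exI[of _ "B + C"] allI order_trans[OF abs_triangle_ineq] add_mono) auto
qed

text \<open>
  The bound outside the ball is what makes this usable against tight sequences. It holds because the
  approximation takes place in the coordinates \<open>sin (x\<^sub>k / R)\<close>, which are injective on the ball and map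
  the whole space into a compact cube; there Tietze and Stone--Weierstrass apply.
\<close>

lemma trig_poly_approx:
  fixes f :: "real^'n \<Rightarrow> real"
  assumes f: "continuous_on UNIV f" and B: "\<And>x. \<bar>f x\<bar> \<le> B" and e: "e > 0"
  obtains h where "trig_poly h" "\<And>x. norm x \<le> K \<Longrightarrow> \<bar>f x - h x\<bar> \<le> e" "\<And>x. \<bar>h x\<bar> \<le> B + e"
proof -
  define R where "R = \<bar>K\<bar> + 1"
  define \<theta> :: "real^'n \<Rightarrow> real^'n" where "\<theta> x = (\<chi> k. sin (x $ k / R))" for x
  have R: "R > 0" "K < R" by (auto simp: R_def)
  have cont: "continuous_on A \<theta>" for A
    unfolding \<theta>_def using R by (intro continuous_intros) auto
  have inj: "inj_on \<theta> (cball 0 K)"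
  proof (rule inj_onI)
    fix x y assume xy: "x \<in> cball 0 K" "y \<in> cball 0 K" "\<theta> x = \<theta> y"
    have bd: "\<bar>z $ k / R\<bar> \<le> 1" if "z \<in> cball 0 K" for z :: "real^'n" and k
      using component_le_norm_cart[of z k] that R by auto
    show "x = y"
      unfolding vec_eq_iff
    proof
      fix k
      have "sin (x $ k / R) = sin (y $ k / R)" using xy(3) by (simp add: \<theta>_def vec_eq_iff)
      moreover have "- (pi / 2) \<le> x $ k / R" "x $ k / R \<le> pi / 2" "- (pi / 2) \<le> y $ k / R" "y $ k / R \<le> pi / 2"
        using bd[OF xy(1), of k] bd[OF xy(2), of k] pi_ge_two by linarith+
      ultimately have "x $ k / R = y $ k / R" by (metis sin_inj_pi)
      then show "x $ k = y $ k" using R by simp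
    qed
  qed
  let ?S = "\<theta> ` cball 0 K"
  have compS: "compact ?S" by (intro compact_continuous_image cont compact_cball)
  obtain i where i: "homeomorphism (cball 0 K) ?S \<theta> i"
    using homeomorphism_compact[OF compact_cball cont refl inj] by blast
  have "B \<ge> 0" using B[of 0] by linarith
  moreover have "continuous_on ?S (\<lambda>z. f (i z))"
    using i by (intro continuous_on_compose2[OF f]) (auto simp: homeomorphism_def)
  moreover have "closedin (top_of_set UNIV) ?S" using compact_imp_closed[OF compS] by simp
  ultimately obtain g where g: "continuous_on UNIV g" "\<And>z. z \<in> ?S \<Longrightarrow> g z = f (i z)" "\<And>z. norm (g z) \<le> B"
    using Tietze[of ?S "\<lambda>z. f (i z)" UNIV B] B by auto
  have "compact (cbox (- 1) (1 :: real^'n))" "continuous_on (cbox (- 1) 1) g"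
    using continuous_on_subset[OF g(1)] by (auto intro: compact_cbox)
  then obtain p where p: "real_polynomial_function p" "\<And>z. z \<in> cbox (- 1) 1 \<Longrightarrow> \<bar>g z - p z\<bar> < e"
    using Stone_Weierstrass_real_polynomial_function e by metis
  have \<theta>box: "\<theta> x \<in> cbox (- 1) 1" for x
    by (simp add: \<theta>_def mem_box_cart)
  have "trig_poly (\<lambda>x. p (\<theta> x))"
    using p(1)
  proof induction
    case (linear l)
    interpret l: bounded_linear l by fact
    have "(\<lambda>x. l (\<theta> x)) = (\<lambda>x. \<Sum>k\<in>UNIV. l (axis k 1) * cos ((axis k (1 / R)) \<bullet> x + (- (pi / 2))))"
    proof
      fix x
      have "l (\<theta> x) = l (\<Sum>k\<in>UNIV. (\<theta> x $ k) *\<^sub>R axis k 1)"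
        using basis_expansion[of "\<theta> x"] by (simp add: scalar_mult_eq_scaleR)
      also have "\<dots> = (\<Sum>k\<in>UNIV. l (axis k 1) * (\<theta> x $ k))"
        by (simp add: l.sum l.scaleR mult.commute)
      also have "\<dots> = (\<Sum>k\<in>UNIV. l (axis k 1) * cos ((axis k (1 / R)) \<bullet> x + (- (pi / 2))))"
        by (simp add: \<theta>_def inner_axis' cos_diff)
      finally show "l (\<theta> x) = \<dots>" .
    qed
    then show ?case by (simp only:) (intro trig_poly_sum trig_poly.cos)
  qed (auto intro: trig_poly_const trig_poly.add trig_poly_mult)
  moreover have "\<bar>f x - p (\<theta> x)\<bar> \<le> e" if "norm x \<le> K" for x
  proof -
    have "i (\<theta> x) = x" "\<theta> x \<in> ?S" using i that by (auto simp: homeomorphism_def)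
    then show ?thesis using g(2)[of "\<theta> x"] p(2)[OF \<theta>box, of x] by simp
  qed
  moreover have "\<bar>p (\<theta> x)\<bar> \<le> B + e" for x
    using g(3)[of "\<theta> x"] p(2)[OF \<theta>box, of x] by simp
  ultimately show ?thesis by (rule that)
qed

lemma (in prob_space) expectation_cos_inner:
  fixes Z :: "'a \<Rightarrow> real^'n"
  assumes [measurable]: "Z \<in> borel_measurable M"
  shows "expectation (\<lambda>\<omega>. a * cos (t \<bullet> Z \<omega> + c)) = a * Re (iexp c * (CLINT \<omega>|M. iexp (t \<bullet> Z \<omega>)))"
proof -
  have int: "integrable M (\<lambda>\<omega>. iexp c * iexp (t \<bullet> Z \<omega>))"
    by (intro integrable_const_bound[of _ 1]) (auto simp: norm_mult)
  have "expectation (\<lambda>\<omega>. cos (t \<bullet> Z \<omega> + c)) = expectation (\<lambda>\<omega>. Re (iexp c * iexp (t \<bullet> Z \<omega>)))"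
    by (simp add: exp_add[symmetric] Re_exp cos_add Im_exp mult_ac)
  also have "\<dots> = Re (CLINT \<omega>|M. iexp c * iexp (t \<bullet> Z \<omega>))"
    by (rule integral_Re[OF int])
  finally show ?thesis by simp
qed

lemma (in prob_space) conv_distr_of_char:
  fixes Z :: "nat \<Rightarrow> 'a \<Rightarrow> real^'n"
  assumes Z[measurable]: "\<And>n. Z n \<in> borel_measurable M" and tight: "tight_seq M Z"
    and L: "sets L = sets borel" "prob_space L"
    and char: "\<And>t. (\<lambda>n. CLINT \<omega>|M. iexp (t \<bullet> Z n \<omega>)) \<longlonglongrightarrow> (CLINT x|L. iexp (t \<bullet> x))"
  shows "conv_distr M Z L"
  unfolding conv_distr_def
proof (intro allI impI)
  interpret L: prob_space L by fact
  note [measurable_cong] = L(1)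
  have trig: "(\<lambda>n. expectation (\<lambda>\<omega>. h (Z n \<omega>))) \<longlonglongrightarrow> L.expectation h" if "trig_poly h" for h
    using that
  proof induction
    case (cos a t c)
    show ?case
      unfolding expectation_cos_inner[OF Z] L.expectation_cos_inner[of "\<lambda>x. x", OF measurable_ident_sets[OF L(1)]]
      by (intro tendsto_intros char)
  next
    case (add f g)
    have [measurable]: "f \<in> borel_measurable borel" "g \<in> borel_measurable borel"
      using add by (auto intro!: borel_measurable_continuous_onI trig_poly_continuous)
    obtain B C where BC: "\<And>x. \<bar>f x\<bar> \<le> B" "\<And>x. \<bar>g x\<bar> \<le> C"
      using trig_poly_bounded[OF add(1)] trig_poly_bounded[OF add(2)] by blast
    have "integrable M (\<lambda>\<omega>. f (Z n \<omega>))" for n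
      using BC(1) by (auto intro!: integrable_const_bound[of _ B])
    moreover have "integrable M (\<lambda>\<omega>. g (Z n \<omega>))" for n
      using BC(2) by (auto intro!: integrable_const_bound[of _ C])
    moreover have "integrable L f"
      using BC(1) by (auto intro!: L.integrable_const_bound[of _ B])
    moreover have "integrable L g"
      using BC(2) by (auto intro!: L.integrable_const_bound[of _ C])
    ultimately show ?case using tendsto_add[OF add.IH] by simp
  qed
  fix f :: "real^'n \<Rightarrow> real"
  assume f: "continuous_on UNIV f" "bounded (range f)"
  from f(2) obtain B where B: "\<And>x. \<bar>f x\<bar> \<le> B" by (auto simp: bounded_iff)
  have B0: "B \<ge> 0" using B[of 0] by linarith
  have [measurable]: "f \<in> borel_measurable borel" by (rule borel_measurable_continuous_onI[OF f(1)])
  show "(\<lambda>n. expectation (\<lambda>\<omega>. f (Z n \<omega>))) \<longlonglongrightarrow> L.expectation f"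
    unfolding tendsto_iff
  proof (intro allI impI)
    fix \<epsilon> :: real assume \<epsilon>: "\<epsilon> > 0"
    define e where "e = min 1 (\<epsilon> / 6)"
    define \<eta> where "\<eta> = \<epsilon> / (6 * (2 * B + 1))"
    have e: "e > 0" "e \<le> 1" "e \<le> \<epsilon> / 6" using \<epsilon> by (auto simp: e_def)
    have \<eta>: "\<eta> > 0" "(2 * B + 1) * \<eta> = \<epsilon> / 6" using \<epsilon> B0 by (auto simp: \<eta>_def field_simps)
    obtain K1 where K1: "\<And>n. \<exists>A\<in>sets M. measure M A < \<eta> \<and> (\<forall>\<omega>\<in>space M - A. norm (Z n \<omega>) \<le> K1)"
      using tight \<eta> unfolding tight_seq_def by blast
    have "(\<lambda>i. measure L {x\<in>space L. real i < norm x}) \<longlonglongrightarrow> measure L (\<Inter>i. {x\<in>space L. real i < norm x})"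
      by (intro L.finite_Lim_measure_decseq) (auto simp: decseq_def)
    moreover have "(\<Inter>i. {x\<in>space L. real i < norm x}) = {}"
      using reals_Archimedean2 by (auto simp: not_less) (meson less_imp_le not_le reals_Archimedean2)
    ultimately have "(\<lambda>i. measure L {x\<in>space L. real i < norm x}) \<longlonglongrightarrow> 0" by simp
    from order_tendstoD(2)[OF this \<eta>(1)] obtain K2 :: nat where K2: "measure L {x\<in>space L. real K2 < norm x} < \<eta>"
      by (auto dest: eventually_happens)
    define K where "K = max K1 (real K2)"
    obtain h where h: "trig_poly h" "\<And>x. norm x \<le> K \<Longrightarrow> \<bar>f x - h x\<bar> \<le> e" "\<And>x. \<bar>h x\<bar> \<le> B + e"
      using trig_poly_approx[OF f(1) B e(1)] by blast
    have [measurable]: "h \<in> borel_measurable borel"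
      using h(1) by (auto intro!: borel_measurable_continuous_onI trig_poly_continuous)
    have bd: "\<bar>f x - h x\<bar> \<le> 2 * B + 1" for x using B[of x] h(3)[of x] e(2) by linarith
    have 1: "\<bar>expectation (\<lambda>\<omega>. f (Z n \<omega>)) - expectation (\<lambda>\<omega>. h (Z n \<omega>))\<bar> \<le> \<epsilon> / 3" for n
    proof -
      obtain A where A: "A \<in> sets M" "measure M A < \<eta>" "\<And>\<omega>. \<omega> \<in> space M - A \<Longrightarrow> norm (Z n \<omega>) \<le> K1"
        using K1 by blast
      have "\<bar>expectation (\<lambda>\<omega>. f (Z n \<omega>) - h (Z n \<omega>))\<bar> \<le> e + (2 * B + 1) * measure M A"
        using A bd e by (intro abs_expectation_le) (auto intro!: h(2) simp: K_def le_max_iff_disj)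
      also have "\<dots> \<le> e + (2 * B + 1) * \<eta>"
        using A(2) B0 by (intro add_left_mono mult_left_mono) auto
      also have "\<dots> \<le> \<epsilon> / 3" using e(3) \<eta>(2) by simp
      also have "expectation (\<lambda>\<omega>. f (Z n \<omega>) - h (Z n \<omega>)) = expectation (\<lambda>\<omega>. f (Z n \<omega>)) - expectation (\<lambda>\<omega>. h (Z n \<omega>))"
        using B h(3) by (intro Bochner_Integration.integral_diff integrable_const_bound[of _ B] integrable_const_bound[of _ "B + e"]) auto
      finally show ?thesis .
    qed
    have 2: "\<bar>L.expectation f - L.expectation h\<bar> \<le> \<epsilon> / 3"
    proof -
      let ?A = "{x\<in>space L. real K2 < norm x}"
      have "\<bar>L.expectation (\<lambda>x. f x - h x)\<bar> \<le> e + (2 * B + 1) * measure L ?A"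
        using bd e by (intro L.abs_expectation_le) (auto intro!: h(2) simp: K_def le_max_iff_disj)
      also have "\<dots> \<le> e + (2 * B + 1) * \<eta>"
        using K2 B0 by (intro add_left_mono mult_left_mono) auto
      also have "\<dots> \<le> \<epsilon> / 3" using e(3) \<eta>(2) by simp
      also have "L.expectation (\<lambda>x. f x - h x) = L.expectation f - L.expectation h"
        using B h(3) by (intro Bochner_Integration.integral_diff L.integrable_const_bound[of _ B] L.integrable_const_bound[of _ "B + e"]) auto
      finally show ?thesis .
    qed
    have "\<forall>\<^sub>F n in sequentially. dist (expectation (\<lambda>\<omega>. h (Z n \<omega>))) (L.expectation h) < \<epsilon> / 3"
      using \<epsilon> by (intro tendstoD[OF trig[OF h(1)]]) auto
    then show "\<forall>\<^sub>F n in sequentially. dist (expectation (\<lambda>\<omega>. f (Z n \<omega>))) (L.expectation f) < \<epsilon>"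
    proof eventually_elim
      case (elim n)
      show ?case using 1[of n] 2 elim unfolding dist_real_def by linarith
    qed
  qed
qed

lemma borel_measurable_vec_nth [measurable (raw)]:
  fixes f :: "'a \<Rightarrow> real^'n"
  assumes "f \<in> borel_measurable M"
  shows "(\<lambda>x. f x $ i) \<in> borel_measurable M"
  by (rule borel_measurable_continuous_on[OF _ assms]) (intro continuous_intros)

lemma square_integrable_mult:
  fixes f g :: "'a \<Rightarrow> real"
  assumes [measurable]: "f \<in> borel_measurable M" "g \<in> borel_measurable M"
    and "integrable M (\<lambda>x. (f x)\<^sup>2)" "integrable M (\<lambda>x. (g x)\<^sup>2)"
  shows "integrable M (\<lambda>x. f x * g x)"
proof (rule Bochner_Integration.integrable_bound)
  show "integrable M (\<lambda>x. (f x)\<^sup>2 + (g x)\<^sup>2)" using assms by auto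
  have "\<bar>f x * g x\<bar> \<le> (f x)\<^sup>2 + (g x)\<^sup>2" for x
  proof -
    have "0 \<le> (\<bar>f x\<bar> - \<bar>g x\<bar>)\<^sup>2" by simp
    then have "2 * \<bar>f x * g x\<bar> \<le> (f x)\<^sup>2 + (g x)\<^sup>2"
      by (simp add: power2_diff abs_mult)
    then show ?thesis using abs_ge_zero[of "f x * g x"] by linarith
  qed
  then show "AE x in M. norm (f x * g x) \<le> norm ((f x)\<^sup>2 + (g x)\<^sup>2)" by simp
qed measurable

lemma borel_measurable_vecI:
  fixes f :: "'a \<Rightarrow> real^'n"
  assumes "\<And>i. (\<lambda>x. f x $ i) \<in> borel_measurable M"
  shows "f \<in> borel_measurable M"
  unfolding borel_measurable_euclidean_space[of f] Basis_vec_def using assms by (auto simp: inner_axis)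

context prob_space
begin

lemma multivariate_central_limit_theorem:
  fixes Z :: "nat \<Rightarrow> 'a \<Rightarrow> real^'n"
  assumes ind: "indep_vars (\<lambda>_. borel) Z UNIV"
    and id: "\<And>i. distr M borel (Z i) = distr M borel (Z 0)"
    and sq: "\<And>a. integrable M (\<lambda>\<omega>. (Z 0 \<omega> $ a)\<^sup>2)"
    and zero: "\<And>a. expectation (\<lambda>\<omega>. Z 0 \<omega> $ a) = 0"
  defines "V \<equiv> (\<chi> a b. expectation (\<lambda>\<omega>. Z 0 \<omega> $ a * Z 0 \<omega> $ b))"
    and "S \<equiv> (\<lambda>n \<omega>. (1 / sqrt (real n)) *\<^sub>R (\<Sum>i<n. Z i \<omega>))"
  shows "tight_seq M S" and "\<exists>L. is_mvnormal0 L V \<and> conv_distr M S L"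
proof -
  have Zm[measurable]: "\<And>i. Z i \<in> borel_measurable M"
    using ind by (auto simp: indep_vars_def)
  have Sm[measurable]: "\<And>n. S n \<in> borel_measurable M" unfolding S_def by measurable
  have transfer: "expectation (\<lambda>\<omega>. f (Z i \<omega>)) = expectation (\<lambda>\<omega>. f (Z 0 \<omega>))"
    "integrable M (\<lambda>\<omega>. f (Z i \<omega>)) \<longleftrightarrow> integrable M (\<lambda>\<omega>. f (Z 0 \<omega>))"
    if [measurable]: "f \<in> borel_measurable borel" for f :: "real^'n \<Rightarrow> real" and i
    using integral_distr[of "Z i" M borel f] integral_distr[of "Z 0" M borel f]
      integrable_distr_eq[of "Z i" M borel f] integrable_distr_eq[of "Z 0" M borel f] id[of i] by auto
  have prod: "integrable M (\<lambda>\<omega>. Z 0 \<omega> $ a * Z 0 \<omega> $ b)" for a b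
    by (intro square_integrable_mult sq) measurable
  have int1: "integrable M (\<lambda>\<omega>. Z 0 \<omega> $ a)" for a
    by (rule square_integrable_imp_integrable[OF _ sq]) measurable
  have quad: "(t \<bullet> x)\<^sup>2 = (\<Sum>a\<in>UNIV. \<Sum>b\<in>UNIV. t $ a * t $ b * (x $ a * x $ b))" for t x :: "real^'n"
    by (simp add: inner_vec_def power2_eq_square sum_product mult_ac)
  have quadV: "t \<bullet> (V *v t) = (\<Sum>a\<in>UNIV. \<Sum>b\<in>UNIV. t $ a * t $ b * V $ a $ b)" for t
    by (simp add: inner_vec_def matrix_vector_mult_def sum_distrib_left mult_ac)
  have var: "integrable M (\<lambda>\<omega>. (t \<bullet> Z 0 \<omega>)\<^sup>2)" "expectation (\<lambda>\<omega>. (t \<bullet> Z 0 \<omega>)\<^sup>2) = t \<bullet> (V *v t)" for t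
    unfolding quad quadV using prod by (auto simp: V_def)
  have mean: "expectation (\<lambda>\<omega>. t \<bullet> Z 0 \<omega>) = 0" for t
    using int1 by (simp add: inner_vec_def zero)
  have U1: "indep_vars (\<lambda>_. borel) (\<lambda>i \<omega>. t \<bullet> Z i \<omega>) UNIV" for t
    by (rule indep_vars_compose2[OF ind, where Y="\<lambda>_ x. t \<bullet> x"]) measurable
  have U2: "integrable M (\<lambda>\<omega>. (t \<bullet> Z i \<omega>)\<^sup>2)" for t i
    using transfer(2)[of "\<lambda>x. (t \<bullet> x)\<^sup>2" i] var by auto
  have U3: "expectation (\<lambda>\<omega>. t \<bullet> Z i \<omega>) = 0" for t i
    using transfer(1)[of "\<lambda>x. t \<bullet> x" i] mean by auto
  have U4: "expectation (\<lambda>\<omega>. (t \<bullet> Z i \<omega>)\<^sup>2) = t \<bullet> (V *v t)" for t i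
    using transfer(1)[of "\<lambda>x. (t \<bullet> x)\<^sup>2" i] var by auto
  have psd: "psd V" unfolding psd_def var(2)[symmetric] by simp
  have sym: "transpose V = V" by (simp add: V_def transpose_def vec_eq_iff mult.commute)
  have inS: "t \<bullet> S n \<omega> = (\<Sum>i<n. t \<bullet> Z i \<omega>) / sqrt (real n)" for t n \<omega>
    by (simp add: S_def inner_sum_right)
  have S2: "integrable M (\<lambda>\<omega>. (t \<bullet> S n \<omega>)\<^sup>2)" "expectation (\<lambda>\<omega>. (t \<bullet> S n \<omega>)\<^sup>2) \<le> t \<bullet> (V *v t)" for t n
    unfolding inS power_divide using second_moment_sum[OF U1 U2 U3 U4, of t n] psd
    by (auto simp: psd_def)
  show tight: "tight_seq M S"
  proof (rule tight_seqI[OF Sm])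
    have nrm: "(norm x)\<^sup>2 = (\<Sum>a\<in>UNIV. (axis a 1 \<bullet> x)\<^sup>2)" for x :: "real^'n"
      unfolding power2_norm_eq_inner inner_vec_def[of x x] by (simp add: inner_axis' power2_eq_square)
    show "integrable M (\<lambda>\<omega>. (norm (S n \<omega>))\<^sup>2)" for n
      unfolding nrm using S2 by auto
    show "expectation (\<lambda>\<omega>. (norm (S n \<omega>))\<^sup>2) \<le> (\<Sum>a\<in>UNIV. axis a 1 \<bullet> (V *v axis a 1))" for n
      unfolding nrm using S2 by (auto intro!: sum_mono)
  qed
  obtain L where L: "is_mvnormal0 L V"
    "\<And>t. (CLINT x|L. iexp (t \<bullet> x)) = complex_of_real (exp (- (t \<bullet> (V *v t)) / 2))"
    using exists_mvnormal0[OF sym psd] by blast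
  have "conv_distr M S L"
  proof (rule conv_distr_of_char[OF Sm tight])
    show "sets L = sets borel" "prob_space L" using L(1) by (auto simp: is_mvnormal0_def)
    fix t :: "real^'n"
    define v where "v = t \<bullet> (V *v t)"
    have v0: "v \<ge> 0" using psd by (simp add: v_def psd_def)
    show "(\<lambda>n. CLINT \<omega>|M. iexp (t \<bullet> S n \<omega>)) \<longlonglongrightarrow> (CLINT x|L. iexp (t \<bullet> x))"
    proof (cases "v = 0")
      case True
      have "AE \<omega> in M. (t \<bullet> Z i \<omega>)\<^sup>2 = 0" for i
        using integral_nonneg_eq_0_iff_AE[of M "\<lambda>\<omega>. (t \<bullet> Z i \<omega>)\<^sup>2"] U2[of t i] U4[of t i] True by (auto simp: v_def)
      then have ae: "AE \<omega> in M. \<forall>i. t \<bullet> Z i \<omega> = 0" by (simp add: AE_all_countable)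
      have "(CLINT \<omega>|M. iexp (t \<bullet> S n \<omega>)) = (CLINT \<omega>|M. 1)" for n
        by (rule integral_cong_AE) (use ae in \<open>auto simp: inS\<close>)
      then show ?thesis unfolding L(2) v_def[symmetric] True by (simp add: prob_space)
    next
      case False
      with v0 have v: "sqrt v > 0" "v > 0" by auto
      have "weak_conv_m (\<lambda>n. distr M borel (\<lambda>\<omega>. (\<Sum>i<n. t \<bullet> Z i \<omega>) / sqrt (real n * (sqrt v)\<^sup>2))) std_normal_distribution"
      proof (rule central_limit_theorem_zero_mean[OF U1 U3 v(1) U2])
        show "variance (\<lambda>\<omega>. t \<bullet> Z i \<omega>) = (sqrt v)\<^sup>2" for i
          using U3[of t i] U4[of t i] v by (simp add: v_def)
        show "distr M borel (\<lambda>\<omega>. t \<bullet> Z i \<omega>) = distr (distr M borel (Z 0)) borel (\<lambda>x. t \<bullet> x)" for i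
          unfolding id[of i, symmetric] by (subst distr_distr) (auto simp: comp_def)
      qed
      from levy_continuity1[OF _ real_dist_normal_dist this, of "sqrt v"]
      have "(\<lambda>n. char (distr M borel (\<lambda>\<omega>. (\<Sum>i<n. t \<bullet> Z i \<omega>) / sqrt (real n * (sqrt v)\<^sup>2))) (sqrt v))
          \<longlonglongrightarrow> complex_of_real (exp (- v / 2))"
        using v by (simp add: char_std_normal_distribution real_distribution_def real_distribution_axioms_def prob_space_distr)
      moreover have "char (distr M borel (\<lambda>\<omega>. (\<Sum>i<n. t \<bullet> Z i \<omega>) / sqrt (real n * (sqrt v)\<^sup>2))) (sqrt v)
          = (CLINT \<omega>|M. iexp (t \<bullet> S n \<omega>))" for n
        unfolding char_def inS using v by (subst integral_distr) (auto simp: real_sqrt_mult)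
      ultimately show ?thesis unfolding L(2) v_def[symmetric] by simp
    qed
  qed
  with L(1) show "\<exists>L. is_mvnormal0 L V \<and> conv_distr M S L" by blast
qed

lemma conv_distr_Slutsky:
  fixes S T :: "nat \<Rightarrow> 'a \<Rightarrow> real^'n"
  assumes [measurable]: "\<And>n. S n \<in> borel_measurable M" "\<And>n. T n \<in> borel_measurable M"
    and tight: "tight_seq M S" and conv: "conv_distr M S L"
    and diff: "((\<lambda>(n, \<omega>). T n \<omega> - S n \<omega>) \<longlongrightarrow> 0) (in_prob M)"
  shows "conv_distr M T L"
  unfolding conv_distr_def
proof (intro allI impI)
  fix f :: "real^'n \<Rightarrow> real"
  assume f: "continuous_on UNIV f" "bounded (range f)"
  from f(2) obtain B where B: "\<And>x. \<bar>f x\<bar> \<le> B" by (auto simp: bounded_iff)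
  have [measurable]: "f \<in> borel_measurable borel" by (rule borel_measurable_continuous_onI[OF f(1)])
  have "((\<lambda>(n, \<omega>). f (T n \<omega>) - f (S n \<omega>)) \<longlongrightarrow> 0) (in_prob M)"
    unfolding tendsto_iff eventually_in_prob
  proof (intro allI impI)
    fix e \<eta> :: real assume e: "e > 0" and \<eta>: "\<eta> > 0"
    then obtain K where K: "\<And>n. \<exists>A\<in>sets M. measure M A < \<eta>/2 \<and> (\<forall>\<omega>\<in>space M - A. norm (S n \<omega>) \<le> K)"
      using tight unfolding tight_seq_def by (meson half_gt_zero)
    have "uniformly_continuous_on (cball 0 (K + 1)) f"
      using continuous_on_subset[OF f(1)] by (intro compact_uniformly_continuous) auto
    then obtain d where d: "d > 0" "\<And>x y. norm x \<le> K + 1 \<Longrightarrow> norm y \<le> K + 1 \<Longrightarrow> dist y x < d \<Longrightarrow> dist (f y) (f x) < e"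
      unfolding uniformly_continuous_on_def using e by (metis mem_cball_0)
    have "eventually (\<lambda>x. dist (case x of (n, \<omega>) \<Rightarrow> T n \<omega> - S n \<omega>) 0 < min d 1) (in_prob M)"
      using d(1) by (intro tendstoD[OF diff]) auto
    then have "\<forall>\<^sub>F n in sequentially. \<exists>A\<in>sets M. measure M A < \<eta>/2 \<and> (\<forall>\<omega>\<in>space M - A. norm (T n \<omega> - S n \<omega>) < min d 1)"
      using half_gt_zero[OF \<eta>] unfolding eventually_in_prob split_conv dist_0_norm dist_norm diff_0_right by blast
    then show "\<forall>\<^sub>F n in sequentially. \<exists>A\<in>sets M. measure M A < \<eta> \<and>
        (\<forall>\<omega>\<in>space M - A. dist (case (n, \<omega>) of (n, \<omega>) \<Rightarrow> f (T n \<omega>) - f (S n \<omega>)) 0 < e)"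
    proof eventually_elim
      case (elim n)
      then obtain A where A: "A \<in> sets M" "measure M A < \<eta>/2" "\<And>\<omega>. \<omega>\<in>space M - A \<Longrightarrow> norm (T n \<omega> - S n \<omega>) < min d 1"
        by blast
      obtain A' where A': "A' \<in> sets M" "measure M A' < \<eta>/2" "\<And>\<omega>. \<omega>\<in>space M - A' \<Longrightarrow> norm (S n \<omega>) \<le> K"
        using K by blast
      have "dist (f (T n \<omega>)) (f (S n \<omega>)) < e" if "\<omega> \<in> space M - (A \<union> A')" for \<omega>
      proof (rule d(2))
        show "norm (S n \<omega>) \<le> K + 1" using A'(3)[of \<omega>] that by simp
        show "norm (T n \<omega>) \<le> K + 1"
          using norm_triangle_sub[of "T n \<omega>" "S n \<omega>"] A'(3)[of \<omega>] A(3)[of \<omega>] that by simp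
        show "dist (T n \<omega>) (S n \<omega>) < d" using A(3)[of \<omega>] that by (simp add: dist_norm)
      qed
      moreover have "measure M (A \<union> A') < \<eta>"
        using measure_Un_le[of A M A'] A A' by simp
      ultimately show ?case using A(1) A'(1)
        by (intro bexI[of _ "A \<union> A'"]) (auto simp: dist_real_def)
    qed
  qed
  then have "(\<lambda>n. expectation (\<lambda>\<omega>. f (T n \<omega>) - f (S n \<omega>))) \<longlonglongrightarrow> 0"
  proof (rule expectation_tendsto_0_in_prob[where B = "2 * B"])
    show "\<bar>f (T n \<omega>) - f (S n \<omega>)\<bar> \<le> 2 * B" for n \<omega>
      using B[of "T n \<omega>"] B[of "S n \<omega>"] by linarith
  qed measurable
  moreover have "expectation (\<lambda>\<omega>. f (T n \<omega>) - f (S n \<omega>)) = expectation (\<lambda>\<omega>. f (T n \<omega>)) - expectation (\<lambda>\<omega>. f (S n \<omega>))" for n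
    using B by (intro Bochner_Integration.integral_diff integrable_const_bound[of _ B]) auto
  moreover have "(\<lambda>n. expectation (\<lambda>\<omega>. f (S n \<omega>))) \<longlonglongrightarrow> integral\<^sup>L L f"
    using conv f by (auto simp: conv_distr_def)
  ultimately show "(\<lambda>n. expectation (\<lambda>\<omega>. f (T n \<omega>))) \<longlonglongrightarrow> integral\<^sup>L L f"
    using Lim_transform by fastforce
qed

end

section \<open>Least squares\<close>

lemma invertible_iff_ker:
  fixes A :: "real^'n^'n"
  shows "invertible A \<longleftrightarrow> (\<forall>x. A *v x = 0 \<longrightarrow> x = 0)"
  unfolding invertible_left_inverse matrix_left_invertible_ker ..

lemma inv0_solves:
  fixes A :: "real^'n^'n"
  assumes "invertible A"
  shows "A *v (inv0 A *v b) = b" "A *v x = b \<Longrightarrow> inv0 A *v b = x"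
proof -
  have inv: "A ** inv0 A = mat 1" "inv0 A ** A = mat 1"
    using someI_ex[OF assms[unfolded invertible_def]] assms by (simp_all add: inv0_def matrix_inv_def)
  show "A *v (inv0 A *v b) = b"
    by (simp add: matrix_vector_mul_assoc inv)
  show "inv0 A *v b = x" if "A *v x = b"
    by (simp add: that[symmetric] matrix_vector_mul_assoc inv)
qed

lemma inv0_cramer:
  fixes A :: "real^'n^'n"
  shows "(inv0 A *v b) $ k = det (\<chi> i j. if j = k then b $ i else A $ i $ j) / det A"
proof (cases "invertible A")
  case True
  then show ?thesis
    using cramer[of A "inv0 A *v b" b] inv0_solves(1)[OF True, of b]
    by (simp add: invertible_det_nz vec_eq_iff)
next
  case False
  then show ?thesis by (simp add: inv0_def invertible_det_nz)
qed

lemma inv0_scaleR: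
  fixes A :: "real^'n^'n"
  assumes c: "c \<noteq> 0"
  shows "inv0 (c *\<^sub>R A) *v (c *\<^sub>R b) = inv0 A *v b"
proof (cases "invertible A")
  case True
  have "invertible (c *\<^sub>R A)"
    using True c by (simp add: invertible_iff_ker flip: scaleR_matrix_vector_assoc)
  moreover have "(c *\<^sub>R A) *v (inv0 A *v b) = c *\<^sub>R b"
    using inv0_solves(1)[OF True, of b] by (simp flip: scaleR_matrix_vector_assoc)
  ultimately show ?thesis by (rule inv0_solves(2))
next
  case False
  then have "\<not> invertible (c *\<^sub>R A)"
    using c by (simp add: invertible_iff_ker flip: scaleR_matrix_vector_assoc)
  with False show ?thesis by (simp add: inv0_def)
qed

lemma tendsto_det:
  fixes A :: "'b \<Rightarrow> real^'n^'n"
  assumes "\<And>i j. ((\<lambda>x. A x $ i $ j) \<longlongrightarrow> A0 $ i $ j) F"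
  shows "((\<lambda>x. det (A x)) \<longlongrightarrow> det A0) F"
  unfolding det_def by (intro tendsto_intros assms)

lemma borel_measurable_det:
  fixes A :: "'b \<Rightarrow> real^'n^'n"
  assumes [measurable]: "\<And>i j. (\<lambda>x. A x $ i $ j) \<in> borel_measurable M"
  shows "(\<lambda>x. det (A x)) \<in> borel_measurable M"
  unfolding det_def by measurable

lemma tendsto_inv0:
  fixes A :: "'b \<Rightarrow> real^'n^'n"
  assumes A: "\<And>i j. ((\<lambda>x. A x $ i $ j) \<longlongrightarrow> A0 $ i $ j) F"
    and b: "\<And>i. ((\<lambda>x. b x $ i) \<longlongrightarrow> b0 $ i) F"
    and inv: "invertible A0"
  shows "((\<lambda>x. (inv0 (A x) *v b x) $ k) \<longlongrightarrow> (inv0 A0 *v b0) $ k) F"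
    and "eventually (\<lambda>x. A x *v (inv0 (A x) *v b x) = b x) F"
proof -
  have "det A0 \<noteq> 0" using inv by (simp add: invertible_det_nz)
  then show "((\<lambda>x. (inv0 (A x) *v b x) $ k) \<longlongrightarrow> (inv0 A0 *v b0) $ k) F"
    unfolding inv0_cramer by (intro tendsto_divide tendsto_det A) (auto intro: A b)
  have "eventually (\<lambda>x. det (A x) \<noteq> 0) F"
    using tendsto_det[OF A] \<open>det A0 \<noteq> 0\<close> by (rule tendsto_imp_eventually_ne)
  then show "eventually (\<lambda>x. A x *v (inv0 (A x) *v b x) = b x) F"
    by eventually_elim (simp add: inv0_solves invertible_det_nz)
qed

lemma borel_measurable_inv0:
  fixes A :: "'b \<Rightarrow> real^'n^'n"
  assumes [measurable]: "\<And>i j. (\<lambda>x. A x $ i $ j) \<in> borel_measurable M"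
    and [measurable]: "\<And>i. (\<lambda>x. b x $ i) \<in> borel_measurable M"
  shows "(\<lambda>x. (inv0 (A x) *v b x) $ k) \<in> borel_measurable M"
proof -
  have "(\<lambda>x. (\<chi> i j. if j = k then b x $ i else A x $ i $ j) $ i $ j) \<in> borel_measurable M" for i j
    by (cases "j = k") auto
  then show ?thesis
    unfolding inv0_cramer by (intro borel_measurable_divide borel_measurable_det) auto
qed

lemma ols_eq_inv0:
  fixes r :: "nat \<Rightarrow> real^'p"
  assumes "c \<noteq> 0"
  shows "ols {i. i < n \<and> P i} r y =
    inv0 (\<chi> a b. c * (\<Sum>i<n. of_bool (P i) * (r i $ a * r i $ b))) *v
      (\<chi> a. c * (\<Sum>i<n. of_bool (P i) * (y i * r i $ a)))"
proof -
  have S: "(\<Sum>i | i < n \<and> P i. f i) = (\<Sum>i<n. of_bool (P i) * f i)" for f :: "nat \<Rightarrow> real"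
    by (rule sum.mono_neutral_cong_left) auto
  have "(\<chi> a b. c * (\<Sum>i<n. of_bool (P i) * (r i $ a * r i $ b))) =
      c *\<^sub>R (\<Sum>i | i < n \<and> P i. (\<chi> a b. r i $ a * r i $ b))"
    by (simp add: vec_eq_iff S)
  moreover have "(\<chi> a. c * (\<Sum>i<n. of_bool (P i) * (y i * r i $ a))) =
      c *\<^sub>R (\<Sum>i | i < n \<and> P i. y i *\<^sub>R r i)"
    by (simp add: vec_eq_iff S)
  ultimately show ?thesis by (simp add: ols_def inv0_scaleR[OF assms])
qed

lemma integral_vec:
  fixes f :: "'n::finite \<Rightarrow> 'a \<Rightarrow> 'b::euclidean_space"
  assumes "\<And>a. integrable M (f a)"
  shows "integrable M (\<lambda>\<omega>. \<chi> a. f a \<omega>)" "(\<integral>\<omega>. (\<chi> a. f a \<omega>) \<partial>M) $ a = (\<integral>\<omega>. f a \<omega> \<partial>M)"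
proof -
  have eq: "(\<chi> a. f a \<omega>) = (\<Sum>a\<in>UNIV. axis a (f a \<omega>))" for \<omega>
    by (simp add: vec_eq_iff axis_def)
  have bl: "bounded_linear (axis a :: 'b \<Rightarrow> 'b^'n)" for a
    by (intro linear_conv_bounded_linear[THEN iffD1] linearI) (auto simp: vec_eq_iff axis_def)
  show int: "integrable M (\<lambda>\<omega>. \<chi> a. f a \<omega>)"
    unfolding eq by (intro Bochner_Integration.integrable_sum integrable_bounded_linear[OF bl] assms)
  show "(\<integral>\<omega>. (\<chi> a. f a \<omega>) \<partial>M) $ a = (\<integral>\<omega>. f a \<omega> \<partial>M)"
    using integral_bounded_linear[OF bounded_linear_vec_nth int, of a] by simp
qed

lemma sum_UNIV_option: "(\<Sum>j\<in>(UNIV :: 'k::finite option set). f j) = f None + (\<Sum>k\<in>UNIV. f (Some k))"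
  by (simp add: UNIV_option_conv sum.reindex)

lemma sum_UNIV_sum:
  "(\<Sum>j\<in>(UNIV :: ('g::finite + 'k::finite) set). f j) = (\<Sum>g\<in>UNIV. f (Inl g)) + (\<Sum>k\<in>UNIV. f (Inr k))"
  unfolding UNIV_Plus_UNIV[symmetric] by (subst sum.Plus) (auto simp: comp_def)

section \<open>The randomized experiment\<close>

locale randomized_experiment = prob_space M
  for M :: "'a measure" +
  fixes D :: "nat \<Rightarrow> 'a \<Rightarrow> 'g::finite"
    and Y :: "nat \<Rightarrow> 'a \<Rightarrow> real^'g"
    and X :: "nat \<Rightarrow> 'a \<Rightarrow> real^'k::finite"
  assumes D_measurable [measurable]: "\<And>i. D i \<in> M \<rightarrow>\<^sub>M count_space UNIV"
    and Y_measurable [measurable]: "\<And>i. Y i \<in> borel_measurable M"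
    and X_measurable [measurable]: "\<And>i. X i \<in> borel_measurable M"
    and indep: "indep_vars (\<lambda>_. count_space UNIV \<Otimes>\<^sub>M borel \<Otimes>\<^sub>M borel)
           (\<lambda>i \<omega>. (D i \<omega>, Y i \<omega>, X i \<omega>)) UNIV"
    and ident: "\<And>i. distr M (count_space UNIV \<Otimes>\<^sub>M borel \<Otimes>\<^sub>M borel) (\<lambda>\<omega>. (D i \<omega>, Y i \<omega>, X i \<omega>))
            = distr M (count_space UNIV \<Otimes>\<^sub>M borel \<Otimes>\<^sub>M borel) (\<lambda>\<omega>. (D 0 \<omega>, Y 0 \<omega>, X 0 \<omega>))"
    and random_assignment: "\<And>A B. B \<in> sets (borel \<Otimes>\<^sub>M borel) \<Longrightarrow>
           measure M {\<omega>\<in>space M. D 0 \<omega> \<in> A \<and> (Y 0 \<omega>, X 0 \<omega>) \<in> B}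
           = measure M {\<omega>\<in>space M. D 0 \<omega> \<in> A} * measure M {\<omega>\<in>space M. (Y 0 \<omega>, X 0 \<omega>) \<in> B}"
    and rho_pos: "\<And>g. rho M (D 0) g > 0"
    and Y_sq: "\<And>g. integrable M (\<lambda>\<omega>. (Y 0 \<omega> $ g)\<^sup>2)"
    and X_sq: "\<And>k. integrable M (\<lambda>\<omega>. (X 0 \<omega> $ k)\<^sup>2)"
    and Sxx_invertible: "invertible (Sxx M (X 0))"
begin

abbreviation obs :: "('g \<times> (real^'g) \<times> (real^'k)) measure" where
  "obs \<equiv> count_space UNIV \<Otimes>\<^sub>M borel \<Otimes>\<^sub>M borel"

abbreviation \<rho> :: "'g \<Rightarrow> real" where "\<rho> \<equiv> rho M (D 0)"

abbreviation \<mu> :: "real^'g" where "\<mu> \<equiv> mu M (Y 0)"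

abbreviation mX :: "real^'k" where "mX \<equiv> expectation (X 0)"

definition unit :: "nat \<Rightarrow> 'a \<Rightarrow> 'g \<times> (real^'g) \<times> (real^'k)" where
  "unit i \<omega> = (D i \<omega>, Y i \<omega>, X i \<omega>)"

definition avg :: "('g \<times> (real^'g) \<times> (real^'k) \<Rightarrow> real) \<Rightarrow> nat \<Rightarrow> 'a \<Rightarrow> real" where
  "avg h n \<omega> = (\<Sum>i<n. h (unit i \<omega>)) / real n"

lemma unit_measurable [measurable]: "unit i \<in> M \<rightarrow>\<^sub>M obs"
  unfolding unit_def[abs_def] by measurable

lemma Wind_measurable [measurable]: "(\<lambda>d. Wind d g) \<in> borel_measurable (count_space UNIV)"
  by simp

lemma unit_iid:
  fixes h :: "'g \<times> (real^'g) \<times> (real^'k) \<Rightarrow> 'c::topological_space"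
  assumes [measurable]: "h \<in> borel_measurable obs"
  shows "indep_vars (\<lambda>_. borel) (\<lambda>i \<omega>. h (unit i \<omega>)) UNIV"
    and "distr M borel (\<lambda>\<omega>. h (unit i \<omega>)) = distr M borel (\<lambda>\<omega>. h (unit 0 \<omega>))"
proof -
  show "indep_vars (\<lambda>_. borel) (\<lambda>i \<omega>. h (unit i \<omega>)) UNIV"
    unfolding unit_def by (rule indep_vars_compose2[OF indep, where Y="\<lambda>_. h"]) measurable
  have "distr M borel (\<lambda>\<omega>. h (unit i \<omega>)) = distr (distr M obs (unit i)) borel h" for i
    by (subst distr_distr) (auto simp: comp_def)
  then show "distr M borel (\<lambda>\<omega>. h (unit i \<omega>)) = distr M borel (\<lambda>\<omega>. h (unit 0 \<omega>))"
    using ident[of i] by (simp add: unit_def[abs_def])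
qed

lemma avg_measurable [measurable (raw)]:
  assumes [measurable]: "h \<in> borel_measurable obs"
  shows "avg h n \<in> borel_measurable M"
  unfolding avg_def[abs_def] by measurable

lemma avg_tendsto:
  assumes h: "h \<in> borel_measurable obs" and int: "integrable M (\<lambda>\<omega>. h (unit 0 \<omega>))"
    and c: "expectation (\<lambda>\<omega>. h (unit 0 \<omega>)) = c"
  shows "((\<lambda>p. avg h (fst p) (snd p)) \<longlongrightarrow> c) (in_prob M)"
  using weak_law_of_large_numbers[OF unit_iid[OF h] int] c by (simp add: avg_def case_prod_unfold)

lemma tight_sqrt_avg:
  assumes h: "h \<in> borel_measurable obs" and sq: "integrable M (\<lambda>\<omega>. (h (unit 0 \<omega>))\<^sup>2)"
    and zero: "expectation (\<lambda>\<omega>. h (unit 0 \<omega>)) = 0"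
  shows "tight_seq M (\<lambda>n \<omega>. sqrt (real n) * avg h n \<omega>)"
proof (rule tight_seqI)
  note [measurable] = h
  have transfer: "expectation (\<lambda>\<omega>. f (h (unit i \<omega>))) = expectation (\<lambda>\<omega>. f (h (unit 0 \<omega>)))"
    "integrable M (\<lambda>\<omega>. f (h (unit i \<omega>))) \<longleftrightarrow> integrable M (\<lambda>\<omega>. f (h (unit 0 \<omega>)))"
    if [measurable]: "f \<in> borel_measurable borel" for f :: "real \<Rightarrow> real" and i
    using integral_distr[of "\<lambda>\<omega>. h (unit i \<omega>)" M borel f] integral_distr[of "\<lambda>\<omega>. h (unit 0 \<omega>)" M borel f]
      integrable_distr_eq[of "\<lambda>\<omega>. h (unit i \<omega>)" M borel f] integrable_distr_eq[of "\<lambda>\<omega>. h (unit 0 \<omega>)" M borel f]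
      unit_iid(2)[OF h, of i] by auto
  define v where "v = expectation (\<lambda>\<omega>. (h (unit 0 \<omega>))\<^sup>2)"
  have S: "integrable M (\<lambda>\<omega>. (\<Sum>i<n. h (unit i \<omega>))\<^sup>2) \<and> expectation (\<lambda>\<omega>. (\<Sum>i<n. h (unit i \<omega>))\<^sup>2) = real n * v" for n
    by (rule second_moment_sum[OF unit_iid(1)[OF h]])
      (use transfer(1)[of "\<lambda>x. x"] transfer[of "\<lambda>x. x\<^sup>2"] sq zero in \<open>auto simp: v_def\<close>)
  have eq: "(norm (sqrt (real n) * avg h n \<omega>))\<^sup>2 = (\<Sum>i<n. h (unit i \<omega>))\<^sup>2 / real n" for n \<omega>
    by (simp add: avg_def power_mult_distrib power_divide) (simp add: power2_eq_square)
  show "(\<lambda>\<omega>. sqrt (real n) * avg h n \<omega>) \<in> borel_measurable M" for n by measurable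
  show "integrable M (\<lambda>\<omega>. (norm (sqrt (real n) * avg h n \<omega>))\<^sup>2)" for n
    unfolding eq using S by auto
  show "expectation (\<lambda>\<omega>. (norm (sqrt (real n) * avg h n \<omega>))\<^sup>2) \<le> v" for n
    unfolding eq using S[of n] by (auto simp: v_def)
qed

lemma indep_var_assignment:
  fixes w :: "'g \<Rightarrow> real" and h :: "(real^'g) \<times> (real^'k) \<Rightarrow> real"
  assumes h [measurable]: "h \<in> borel_measurable (borel \<Otimes>\<^sub>M borel)"
  shows "indep_var borel (\<lambda>\<omega>. w (D 0 \<omega>)) borel (\<lambda>\<omega>. h (Y 0 \<omega>, X 0 \<omega>))"
  unfolding indep_var_eq
proof (intro conjI)
  have w [measurable]: "(\<lambda>\<omega>. w (D 0 \<omega>)) \<in> borel_measurable M"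
    by (rule measurable_compose[OF D_measurable]) simp
  then show "(\<lambda>\<omega>. w (D 0 \<omega>)) \<in> borel_measurable M" .
  show hm: "(\<lambda>\<omega>. h (Y 0 \<omega>, X 0 \<omega>)) \<in> borel_measurable M" by measurable
  have stable: "Int_stable {f -` A \<inter> space M | A. A \<in> sets borel}" for f :: "'a \<Rightarrow> real"
  proof (rule Int_stableI)
    fix a b assume "a \<in> {f -` A \<inter> space M | A. A \<in> sets borel}" "b \<in> {f -` A \<inter> space M | A. A \<in> sets borel}"
    then obtain A B where "A \<in> sets borel" "B \<in> sets borel" "a = f -` A \<inter> space M" "b = f -` B \<inter> space M" by blast
    then show "a \<inter> b \<in> {f -` A \<inter> space M | A. A \<in> sets borel}"
      by (intro CollectI exI[of _ "A \<inter> B"]) auto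
  qed
  show "indep_set (sigma_sets (space M) {(\<lambda>\<omega>. w (D 0 \<omega>)) -` A \<inter> space M | A. A \<in> sets borel})
     (sigma_sets (space M) {(\<lambda>\<omega>. h (Y 0 \<omega>, X 0 \<omega>)) -` A \<inter> space M | A. A \<in> sets borel})"
  proof (rule indep_set_sigma_sets[OF indep_setI stable stable])
    show "{(\<lambda>\<omega>. w (D 0 \<omega>)) -` A \<inter> space M | A. A \<in> sets borel} \<subseteq> events"
      using measurable_sets[OF w] by blast
    show "{(\<lambda>\<omega>. h (Y 0 \<omega>, X 0 \<omega>)) -` A \<inter> space M | A. A \<in> sets borel} \<subseteq> events"
      using measurable_sets[OF hm] by blast
    fix a b
    assume "a \<in> {(\<lambda>\<omega>. w (D 0 \<omega>)) -` A \<inter> space M | A. A \<in> sets borel}"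
      "b \<in> {(\<lambda>\<omega>. h (Y 0 \<omega>, X 0 \<omega>)) -` A \<inter> space M | A. A \<in> sets borel}"
    then obtain A B where B: "B \<in> sets borel"
      and ab: "a = (\<lambda>\<omega>. w (D 0 \<omega>)) -` A \<inter> space M" "b = (\<lambda>\<omega>. h (Y 0 \<omega>, X 0 \<omega>)) -` B \<inter> space M" by blast
    have "h -` B \<in> sets (borel \<Otimes>\<^sub>M borel)"
      using measurable_sets[OF h B] by (simp add: space_pair_measure)
    moreover have "a \<inter> b = {\<omega>\<in>space M. D 0 \<omega> \<in> w -` A \<and> (Y 0 \<omega>, X 0 \<omega>) \<in> h -` B}"
      "a = {\<omega>\<in>space M. D 0 \<omega> \<in> w -` A}" "b = {\<omega>\<in>space M. (Y 0 \<omega>, X 0 \<omega>) \<in> h -` B}" using ab by auto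
    ultimately show "prob (a \<inter> b) = prob a * prob b" using random_assignment[of "h -` B" "w -` A"] by simp
  qed
qed

lemma expectation_Wind: "expectation (\<lambda>\<omega>. Wind (D 0 \<omega>) g) = \<rho> g"
proof -
  have "(\<lambda>\<omega>. Wind (D 0 \<omega>) g) = indicator (D 0 -` {g})" by (auto simp: Wind_def indicator_def)
  moreover have "D 0 -` {g} \<inter> space M = {\<omega>\<in>space M. D 0 \<omega> = g}" by auto
  ultimately show ?thesis by (simp add: rho_def)
qed

lemma integrable_Wind: "integrable M (\<lambda>\<omega>. Wind (D 0 \<omega>) g)"
  by (rule integrable_const_bound[of _ 1]) (auto simp: Wind_def)

lemma Wind_mult:
  fixes h :: "(real^'g) \<times> (real^'k) \<Rightarrow> real"
  assumes [measurable]: "h \<in> borel_measurable (borel \<Otimes>\<^sub>M borel)"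
    and int: "integrable M (\<lambda>\<omega>. h (Y 0 \<omega>, X 0 \<omega>))"
  shows "integrable M (\<lambda>\<omega>. Wind (D 0 \<omega>) g * h (Y 0 \<omega>, X 0 \<omega>))"
    and "expectation (\<lambda>\<omega>. Wind (D 0 \<omega>) g * h (Y 0 \<omega>, X 0 \<omega>)) = \<rho> g * expectation (\<lambda>\<omega>. h (Y 0 \<omega>, X 0 \<omega>))"
proof -
  have iv: "indep_var borel (\<lambda>\<omega>. Wind (D 0 \<omega>) g) borel (\<lambda>\<omega>. h (Y 0 \<omega>, X 0 \<omega>))"
    by (rule indep_var_assignment) measurable
  show "integrable M (\<lambda>\<omega>. Wind (D 0 \<omega>) g * h (Y 0 \<omega>, X 0 \<omega>))"
    by (rule indep_var_integrable[OF iv integrable_Wind int])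
  show "expectation (\<lambda>\<omega>. Wind (D 0 \<omega>) g * h (Y 0 \<omega>, X 0 \<omega>)) = \<rho> g * expectation (\<lambda>\<omega>. h (Y 0 \<omega>, X 0 \<omega>))"
    by (simp add: indep_var_lebesgue_integral[OF iv integrable_Wind int] expectation_Wind)
qed

lemma X_int: "integrable M (\<lambda>\<omega>. X 0 \<omega> $ k)"
  by (rule square_integrable_imp_integrable[OF _ X_sq]) measurable

lemma Y_int: "integrable M (\<lambda>\<omega>. Y 0 \<omega> $ g)"
  by (rule square_integrable_imp_integrable[OF _ Y_sq]) measurable

lemma XX_int: "integrable M (\<lambda>\<omega>. X 0 \<omega> $ k * X 0 \<omega> $ l)"
  by (intro square_integrable_mult X_sq) measurable

lemma YX_int: "integrable M (\<lambda>\<omega>. Y 0 \<omega> $ g * X 0 \<omega> $ k)"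
  by (intro square_integrable_mult X_sq Y_sq) measurable

lemma expectation_X: "expectation (\<lambda>\<omega>. X 0 \<omega> $ k) = mX $ k"
  using integral_vec(2)[of M "\<lambda>k \<omega>. X 0 \<omega> $ k" k] X_int by simp

lemma expectation_Y: "expectation (\<lambda>\<omega>. Y 0 \<omega> $ g) = \<mu> $ g"
  by (simp add: mu_def)

lemma Xdot_nth: "Xdot M (X 0) \<omega> $ k = X 0 \<omega> $ k - mX $ k"
  by (simp add: Xdot_def)

lemma Sxx_nth: "Sxx M (X 0) $ k $ l = expectation (\<lambda>\<omega>. X 0 \<omega> $ k * X 0 \<omega> $ l) - mX $ k * mX $ l"
proof -
  have i: "integrable M (\<lambda>\<omega>. Xdot M (X 0) \<omega> $ a * Xdot M (X 0) \<omega> $ b)" for a b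
    unfolding Xdot_nth using X_int XX_int by (simp add: algebra_simps)
  have "Sxx M (X 0) $ k $ l = expectation (\<lambda>\<omega>. Xdot M (X 0) \<omega> $ k * Xdot M (X 0) \<omega> $ l)"
    unfolding Sxx_def using i by (simp add: integral_vec)
  also have "\<dots> = expectation (\<lambda>\<omega>. X 0 \<omega> $ k * X 0 \<omega> $ l) - mX $ k * mX $ l"
    unfolding Xdot_nth using X_int XX_int by (simp add: algebra_simps prob_space expectation_X)
  finally show ?thesis .
qed

lemma Sxx_beta_g:
  "(Sxx M (X 0) *v beta_g M (Y 0) (X 0) g) $ k = expectation (\<lambda>\<omega>. Y 0 \<omega> $ g * X 0 \<omega> $ k) - \<mu> $ g * mX $ k"
proof -
  have i: "integrable M (\<lambda>\<omega>. (Y 0 \<omega> $ g - \<mu> $ g) * Xdot M (X 0) \<omega> $ k)" for k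
    unfolding Xdot_nth using X_int Y_int YX_int by (simp add: algebra_simps)
  have "(Sxx M (X 0) *v beta_g M (Y 0) (X 0) g) $ k =
      expectation (\<lambda>\<omega>. \<chi> k. (Y 0 \<omega> $ g - \<mu> $ g) * Xdot M (X 0) \<omega> $ k) $ k"
    unfolding beta_g_def inv0_solves(1)[OF Sxx_invertible] by (simp add: scaleR_vec_def)
  also have "\<dots> = expectation (\<lambda>\<omega>. (Y 0 \<omega> $ g - \<mu> $ g) * Xdot M (X 0) \<omega> $ k)"
    using i by (simp add: integral_vec)
  also have "\<dots> = expectation (\<lambda>\<omega>. Y 0 \<omega> $ g * X 0 \<omega> $ k) - \<mu> $ g * mX $ k"
    unfolding Xdot_nth using X_int Y_int YX_int
    by (simp add: algebra_simps prob_space expectation_X expectation_Y)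
  finally show ?thesis .
qed

lemma Y_obs: "Y 0 \<omega> $ D 0 \<omega> = (\<Sum>g\<in>UNIV. Wind (D 0 \<omega>) g * Y 0 \<omega> $ g)"
  by (simp add: Wind_def if_distrib[of "\<lambda>x. x * _"] cong: if_cong)

lemma WY_int: "integrable M (\<lambda>\<omega>. Wind (D 0 \<omega>) g * Y 0 \<omega> $ g)"
  using Wind_mult(1)[of "\<lambda>(y, x). y $ g"] Y_int by simp

lemma WYX_int: "integrable M (\<lambda>\<omega>. Wind (D 0 \<omega>) g * (Y 0 \<omega> $ g * X 0 \<omega> $ k))"
  using Wind_mult(1)[of "\<lambda>(y, x). y $ g * x $ k"] YX_int by simp

lemma obs_int:
  "integrable M (\<lambda>\<omega>. Y 0 \<omega> $ D 0 \<omega>)" "integrable M (\<lambda>\<omega>. Y 0 \<omega> $ D 0 \<omega> * X 0 \<omega> $ k)"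
  unfolding Y_obs using WY_int WYX_int by (auto simp: sum_distrib_right mult.assoc)

lemma Sxx_beta_obs:
  "(Sxx M (X 0) *v beta_obs M (D 0) (Y 0) (X 0)) $ k =
    expectation (\<lambda>\<omega>. Y 0 \<omega> $ D 0 \<omega> * X 0 \<omega> $ k) - expectation (\<lambda>\<omega>. Y 0 \<omega> $ D 0 \<omega>) * mX $ k"
proof -
  have i: "integrable M (\<lambda>\<omega>. Y 0 \<omega> $ D 0 \<omega> * Xdot M (X 0) \<omega> $ k)" for k
    unfolding Xdot_nth using obs_int by (simp add: algebra_simps)
  have "(Sxx M (X 0) *v beta_obs M (D 0) (Y 0) (X 0)) $ k =
      expectation (\<lambda>\<omega>. \<chi> k. Y 0 \<omega> $ D 0 \<omega> * Xdot M (X 0) \<omega> $ k) $ k"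
    unfolding beta_obs_def inv0_solves(1)[OF Sxx_invertible] by (simp add: scaleR_vec_def)
  also have "\<dots> = expectation (\<lambda>\<omega>. Y 0 \<omega> $ D 0 \<omega> * Xdot M (X 0) \<omega> $ k)"
    using i by (simp add: integral_vec)
  also have "\<dots> = expectation (\<lambda>\<omega>. Y 0 \<omega> $ D 0 \<omega> * X 0 \<omega> $ k) - expectation (\<lambda>\<omega>. Y 0 \<omega> $ D 0 \<omega>) * mX $ k"
    unfolding Xdot_nth using obs_int by (simp add: algebra_simps)
  finally show ?thesis .
qed

abbreviation wt :: "'g \<Rightarrow> 'g \<times> (real^'g) \<times> (real^'k) \<Rightarrow> real" where
  "wt g u \<equiv> Wind (fst u) g"

abbreviation out :: "'g \<Rightarrow> 'g \<times> (real^'g) \<times> (real^'k) \<Rightarrow> real" where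
  "out g u \<equiv> fst (snd u) $ g"

abbreviation cov :: "'k \<Rightarrow> 'g \<times> (real^'g) \<times> (real^'k) \<Rightarrow> real" where
  "cov k u \<equiv> snd (snd u) $ k"

lemma unit_sel [simp]: "fst (unit i \<omega>) = D i \<omega>" "fst (snd (unit i \<omega>)) = Y i \<omega>" "snd (snd (unit i \<omega>)) = X i \<omega>"
  by (simp_all add: unit_def)

lemma avg_linear:
  "avg (\<lambda>u. f u + h u) n \<omega> = avg f n \<omega> + avg h n \<omega>"
  "avg (\<lambda>u. f u - h u) n \<omega> = avg f n \<omega> - avg h n \<omega>"
  "avg (\<lambda>u. f u * c) n \<omega> = avg f n \<omega> * c"
  "avg (\<lambda>u. f u / c) n \<omega> = avg f n \<omega> / c"
  "avg (\<lambda>u. \<Sum>k\<in>I. F k u) n \<omega> = (\<Sum>k\<in>I. avg (F k) n \<omega>)"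
proof -
  show "avg (\<lambda>u. \<Sum>k\<in>I. F k u) n \<omega> = (\<Sum>k\<in>I. avg (F k) n \<omega>)"
    unfolding avg_def by (subst sum.swap) (simp add: sum_divide_distrib)
qed (simp_all add: avg_def sum.distrib add_divide_distrib sum_subtractf diff_divide_distrib
      flip: sum_divide_distrib sum_distrib_right)

lemma avg_const: "n > 0 \<Longrightarrow> avg (\<lambda>u. c) n \<omega> = c"
  by (simp add: avg_def)

text \<open>
  The influence function of \<open>Ybar\<^sub>g - (Xbar\<^sub>g - Xbar) \<bullet> c\<close> when \<open>c\<close> is consistent for \<open>b g\<close>, where the
  subscript denotes the mean over the units with treatment \<open>g\<close>.
\<close>

definition infl :: "('g \<Rightarrow> real^'k) \<Rightarrow> 'g \<times> (real^'g) \<times> (real^'k) \<Rightarrow> real^'g" where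
  "infl b u = (\<chi> g. wt g u * (out g u - \<mu> $ g - (snd (snd u) - mX) \<bullet> b g) / \<rho> g + (snd (snd u) - mX) \<bullet> b g)"

lemma infl_measurable [measurable]: "infl b \<in> borel_measurable obs"
  unfolding infl_def by (intro borel_measurable_vecI) simp

lemma inner_Xc_sq: "integrable M (\<lambda>\<omega>. ((X 0 \<omega> - mX) \<bullet> b)\<^sup>2)"
proof -
  have "((X 0 \<omega> - mX) \<bullet> b)\<^sup>2 = (\<Sum>k\<in>UNIV. \<Sum>l\<in>UNIV. ((X 0 \<omega> $ k - mX $ k) * (X 0 \<omega> $ l - mX $ l)) * (b $ k * b $ l))" for \<omega>
    by (simp add: inner_vec_def power2_eq_square sum_product mult_ac)
  moreover have "integrable M (\<lambda>\<omega>. (X 0 \<omega> $ k - mX $ k) * (X 0 \<omega> $ l - mX $ l))" for k l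
    using X_int XX_int by (simp add: algebra_simps)
  ultimately show ?thesis by simp
qed

lemma inner_Xc_int: "integrable M (\<lambda>\<omega>. (X 0 \<omega> - mX) \<bullet> b)"
  by (rule square_integrable_imp_integrable[OF _ inner_Xc_sq]) measurable

lemma inner_Xc_zero: "expectation (\<lambda>\<omega>. (X 0 \<omega> - mX) \<bullet> b) = 0"
  unfolding inner_vec_def using X_int by (simp add: expectation_X prob_space)

lemma resid_sq: "integrable M (\<lambda>\<omega>. (Y 0 \<omega> $ g - \<mu> $ g - (X 0 \<omega> - mX) \<bullet> b)\<^sup>2)"
proof -
  have "(Y 0 \<omega> $ g - \<mu> $ g - (X 0 \<omega> - mX) \<bullet> b)\<^sup>2 = (Y 0 \<omega> $ g)\<^sup>2 + (\<mu> $ g)\<^sup>2 + ((X 0 \<omega> - mX) \<bullet> b)\<^sup>2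
      - 2 * \<mu> $ g * Y 0 \<omega> $ g + 2 * \<mu> $ g * ((X 0 \<omega> - mX) \<bullet> b) - 2 * (Y 0 \<omega> $ g * ((X 0 \<omega> - mX) \<bullet> b))" for \<omega>
    by (simp add: power2_eq_square algebra_simps)
  moreover have "integrable M (\<lambda>\<omega>. Y 0 \<omega> $ g * ((X 0 \<omega> - mX) \<bullet> b))"
    by (intro square_integrable_mult Y_sq inner_Xc_sq) measurable
  ultimately show ?thesis using Y_sq Y_int inner_Xc_sq inner_Xc_int by simp
qed

lemma resid_int: "integrable M (\<lambda>\<omega>. Y 0 \<omega> $ g - \<mu> $ g - (X 0 \<omega> - mX) \<bullet> b)"
  by (rule square_integrable_imp_integrable[OF _ resid_sq]) measurable

lemma resid_zero: "expectation (\<lambda>\<omega>. Y 0 \<omega> $ g - \<mu> $ g - (X 0 \<omega> - mX) \<bullet> b) = 0"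
  using Y_int inner_Xc_int by (simp add: expectation_Y inner_Xc_zero prob_space)

lemma infl_sq: "integrable M (\<lambda>\<omega>. (infl b (unit 0 \<omega>) $ g)\<^sup>2)"
proof -
  let ?e = "\<lambda>(y, x). y $ g - \<mu> $ g - (x - mX) \<bullet> b g" and ?q = "\<lambda>(y :: real^'g, x). (x - mX) \<bullet> b g"
  have "integrable M (\<lambda>\<omega>. ?e (Y 0 \<omega>, X 0 \<omega>) * ?q (Y 0 \<omega>, X 0 \<omega>))"
    using resid_sq[of g "b g"] inner_Xc_sq[of "b g"] by (intro square_integrable_mult) auto
  then have "integrable M (\<lambda>\<omega>. Wind (D 0 \<omega>) g * (?e (Y 0 \<omega>, X 0 \<omega>))\<^sup>2)"
    "integrable M (\<lambda>\<omega>. Wind (D 0 \<omega>) g * (?e (Y 0 \<omega>, X 0 \<omega>) * ?q (Y 0 \<omega>, X 0 \<omega>)))"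
    using Wind_mult(1)[of "\<lambda>z. (?e z)\<^sup>2"] Wind_mult(1)[of "\<lambda>z. ?e z * ?q z"] resid_sq[of g "b g"] by simp_all
  moreover have "(infl b (unit 0 \<omega>) $ g)\<^sup>2 = Wind (D 0 \<omega>) g * (?e (Y 0 \<omega>, X 0 \<omega>))\<^sup>2 / (\<rho> g)\<^sup>2
      + 2 * (Wind (D 0 \<omega>) g * (?e (Y 0 \<omega>, X 0 \<omega>) * ?q (Y 0 \<omega>, X 0 \<omega>))) / \<rho> g + (?q (Y 0 \<omega>, X 0 \<omega>))\<^sup>2" for \<omega>
    by (simp add: infl_def Wind_def power2_sum power_divide)
  ultimately show ?thesis using inner_Xc_sq[of "b g"] by simp
qed

lemma infl_zero: "expectation (\<lambda>\<omega>. infl b (unit 0 \<omega>) $ g) = 0"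
  using Wind_mult[of "\<lambda>(y, x). y $ g - \<mu> $ g - (x - mX) \<bullet> b g" g] resid_int[of g "b g"] resid_zero[of g "b g"]
    inner_Xc_int[of "b g"] inner_Xc_zero[of "b g"]
  by (simp add: infl_def)

text \<open>
  Consistency of \<open>bh\<close> suffices, without a rate: it multiplies differences of covariate means, which
  are of order \<open>1 / sqrt n\<close>. A rate would need fourth moments.
\<close>

lemma asymptotic_normality:
  fixes est :: "nat \<Rightarrow> 'a \<Rightarrow> real^'g" and bh :: "'g \<Rightarrow> nat \<Rightarrow> 'a \<Rightarrow> real^'k"
  assumes est [measurable]: "\<And>n. est n \<in> borel_measurable M"
    and bh: "\<And>g k. ((\<lambda>p. bh g (fst p) (snd p) $ k) \<longlongrightarrow> b g $ k) (in_prob M)"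
    and rep: "\<And>g. eventually (\<lambda>p. est (fst p) (snd p) $ g - \<mu> $ g =
        avg (\<lambda>u. wt g u * (out g u - \<mu> $ g)) (fst p) (snd p) / avg (wt g) (fst p) (snd p)
        - (\<Sum>k\<in>UNIV. (avg (\<lambda>u. wt g u * (cov k u - mX $ k)) (fst p) (snd p) / avg (wt g) (fst p) (snd p)
              - avg (\<lambda>u. cov k u - mX $ k) (fst p) (snd p)) * bh g (fst p) (snd p) $ k)) (in_prob M)"
  shows "\<exists>L. is_mvnormal0 L (\<chi> a c. expectation (\<lambda>\<omega>. infl b (unit 0 \<omega>) $ a * infl b (unit 0 \<omega>) $ c)) \<and>
    conv_distr M (\<lambda>n \<omega>. sqrt (real n) *\<^sub>R (est n \<omega> - \<mu>)) L"
proof -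
  define S where "S = (\<lambda>n \<omega>. (1 / sqrt (real n)) *\<^sub>R (\<Sum>i<n. infl b (unit i \<omega>)))"
  have [measurable]: "S n \<in> borel_measurable M" for n unfolding S_def by measurable
  note clt = multivariate_central_limit_theorem[OF unit_iid[OF infl_measurable] infl_sq infl_zero, of b, folded S_def]
  obtain L where L: "is_mvnormal0 L (\<chi> a c. expectation (\<lambda>\<omega>. infl b (unit 0 \<omega>) $ a * infl b (unit 0 \<omega>) $ c))" "conv_distr M S L"
    using clt(2) by blast
  have "((\<lambda>p. sqrt (real (fst p)) *\<^sub>R (est (fst p) (snd p) - \<mu>) - S (fst p) (snd p)) \<longlongrightarrow> 0) (in_prob M)"
  proof (rule vec_tendstoI)
    fix g
    let ?P = "\<lambda>n \<omega>. sqrt (real n) * avg (\<lambda>u. wt g u * (out g u - \<mu> $ g)) n \<omega>"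
    let ?U = "\<lambda>k n \<omega>. sqrt (real n) * avg (\<lambda>u. wt g u * (cov k u - mX $ k)) n \<omega>"
    let ?V = "\<lambda>k n \<omega>. sqrt (real n) * avg (\<lambda>u. cov k u - mX $ k) n \<omega>"
    let ?w = "\<lambda>p. avg (wt g) (fst p) (snd p)"
    let ?b = "\<lambda>k p. bh g (fst p) (snd p) $ k"
    have Wsq: "(Wind d g * a)\<^sup>2 = Wind d g * a\<^sup>2" for d and a :: real by (simp add: Wind_def)
    have Xc: "X 0 \<omega> $ k - mX $ k = (X 0 \<omega> - mX) \<bullet> axis k 1" for \<omega> k by (simp add: inner_axis)
    have tP: "tight_seq M ?P"
      using Wind_mult(1)[of "\<lambda>(y, x). (y $ g - \<mu> $ g)\<^sup>2" g] Wind_mult(2)[of "\<lambda>(y, x). y $ g - \<mu> $ g" g]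
        resid_sq[of g 0] resid_int[of g 0] resid_zero[of g 0]
      by (intro tight_sqrt_avg) (simp_all add: Wsq)
    have tU: "tight_seq M (?U k)" for k
      using Wind_mult(1)[of "\<lambda>(y, x). (x $ k - mX $ k)\<^sup>2" g] Wind_mult(2)[of "\<lambda>(y, x). x $ k - mX $ k" g]
        inner_Xc_sq[of "axis k 1"] inner_Xc_int[of "axis k 1"] inner_Xc_zero[of "axis k 1"]
      by (intro tight_sqrt_avg) (simp_all add: Wsq Xc[symmetric])
    have tV: "tight_seq M (?V k)" for k
      using inner_Xc_sq[of "axis k 1"] inner_Xc_int[of "axis k 1"] inner_Xc_zero[of "axis k 1"]
      by (intro tight_sqrt_avg) (simp_all add: Xc[symmetric])
    have w: "(?w \<longlongrightarrow> \<rho> g) (in_prob M)"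
      by (rule avg_tendsto) (auto simp: integrable_Wind expectation_Wind)
    have \<rho>: "\<rho> g \<noteq> 0" using rho_pos[of g] by simp
    have slut: "((\<lambda>p. Z (fst p) (snd p) * U p) \<longlongrightarrow> 0) (in_prob M)"
      if "tight_seq M Z" "(U \<longlongrightarrow> c) (in_prob M)" "c = 0" for Z :: "nat \<Rightarrow> 'a \<Rightarrow> real" and U c
      using tendsto_mult_tight[of U Z] that by (simp add: case_prod_unfold)
    have t1: "((\<lambda>p. ?P (fst p) (snd p) * (1 / ?w p - 1 / \<rho> g)) \<longlongrightarrow> 0) (in_prob M)"
      by (rule slut[OF tP tendsto_diff[OF tendsto_divide[OF tendsto_const w \<rho>] tendsto_const]]) simp
    have t2: "((\<lambda>p. ?U k (fst p) (snd p) * (?b k p / ?w p - b g $ k / \<rho> g)) \<longlongrightarrow> 0) (in_prob M)" for k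
      by (rule slut[OF tU tendsto_diff[OF tendsto_divide[OF bh w \<rho>] tendsto_const]]) simp
    have t3: "((\<lambda>p. ?V k (fst p) (snd p) * (?b k p - b g $ k)) \<longlongrightarrow> 0) (in_prob M)" for k
      by (rule slut[OF tV tendsto_diff[OF bh tendsto_const]]) simp
    have "((\<lambda>p. ?P (fst p) (snd p) * (1 / ?w p - 1 / \<rho> g)
        - (\<Sum>k\<in>UNIV. ?U k (fst p) (snd p) * (?b k p / ?w p - b g $ k / \<rho> g)
             - ?V k (fst p) (snd p) * (?b k p - b g $ k))) \<longlongrightarrow> 0 - (\<Sum>k\<in>(UNIV::'k set). 0 - 0)) (in_prob M)"
      by (intro tendsto_diff tendsto_sum t1 t2 t3)
    then have lim: "((\<lambda>p. ?P (fst p) (snd p) * (1 / ?w p - 1 / \<rho> g)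
        - (\<Sum>k\<in>UNIV. ?U k (fst p) (snd p) * (?b k p / ?w p - b g $ k / \<rho> g)
             - ?V k (fst p) (snd p) * (?b k p - b g $ k))) \<longlongrightarrow> 0) (in_prob M)" by simp
    have Sg: "S n \<omega> $ g = ?P n \<omega> / \<rho> g - (\<Sum>k\<in>UNIV. (?U k n \<omega> / \<rho> g - ?V k n \<omega>) * b g $ k)" for n \<omega>
    proof -
      have "S n \<omega> $ g = sqrt (real n) * avg (\<lambda>u. infl b u $ g) n \<omega>"
      proof -
        have "sqrt (real n) * (s / real n) = s / sqrt (real n)" for s
          unfolding divide_inverse[of s "sqrt (real n)"] sqrt_divide_self_eq[OF of_nat_0_le_iff, symmetric] by simp
        then show ?thesis by (simp only: avg_def) (simp add: S_def)
      qed
      also have "(\<lambda>u. infl b u $ g) = (\<lambda>u. wt g u * (out g u - \<mu> $ g) / \<rho> g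
          - (\<Sum>k\<in>UNIV. (wt g u * (cov k u - mX $ k) / \<rho> g - (cov k u - mX $ k)) * b g $ k))"
        by (simp add: infl_def inner_vec_def fun_eq_iff left_diff_distrib right_diff_distrib diff_divide_distrib sum_subtractf
            sum_distrib_left sum_divide_distrib mult_ac)
      finally show ?thesis by (simp only: avg_linear) (simp add: algebra_simps sum_distrib_left)
    qed
    show "((\<lambda>p. (sqrt (real (fst p)) *\<^sub>R (est (fst p) (snd p) - \<mu>) - S (fst p) (snd p)) $ g) \<longlongrightarrow> 0 $ g) (in_prob M)"
      unfolding zero_index
    proof (rule Lim_transform_eventually[OF lim])
      show "\<forall>\<^sub>F p in in_prob M. ?P (fst p) (snd p) * (1 / ?w p - 1 / \<rho> g)
        - (\<Sum>k\<in>UNIV. ?U k (fst p) (snd p) * (?b k p / ?w p - b g $ k / \<rho> g)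
             - ?V k (fst p) (snd p) * (?b k p - b g $ k)) =
        (sqrt (real (fst p)) *\<^sub>R (est (fst p) (snd p) - \<mu>) - S (fst p) (snd p)) $ g"
        using rep[of g]
      proof eventually_elim
        case (elim p)
        have "(sqrt (real (fst p)) *\<^sub>R (est (fst p) (snd p) - \<mu>) - S (fst p) (snd p)) $ g =
          sqrt (real (fst p)) * (est (fst p) (snd p) $ g - \<mu> $ g) - S (fst p) (snd p) $ g"
          by simp
        then show ?case
          unfolding elim Sg
          by (simp add: right_diff_distrib left_diff_distrib sum_subtractf sum_distrib_left mult_ac)
      qed
    qed
  qed
  then have "conv_distr M (\<lambda>n \<omega>. sqrt (real n) *\<^sub>R (est n \<omega> - \<mu>)) L"
    by (intro conv_distr_Slutsky[OF _ _ clt(1) L(2)]) (auto simp: case_prod_unfold)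
  with L(1) show ?thesis by blast
qed

lemma adjusted_mean_centered:
  assumes n: "n > 0" and w: "avg (wt g) n \<omega> \<noteq> 0"
    and e: "avg (wt g) n \<omega> * e = avg (\<lambda>u. wt g u * out g u) n \<omega>
      - (\<Sum>k\<in>UNIV. (avg (\<lambda>u. wt g u * cov k u) n \<omega> - avg (wt g) n \<omega> * avg (cov k) n \<omega>) * c $ k)"
  shows "e - \<mu> $ g = avg (\<lambda>u. wt g u * (out g u - \<mu> $ g)) n \<omega> / avg (wt g) n \<omega>
        - (\<Sum>k\<in>UNIV. (avg (\<lambda>u. wt g u * (cov k u - mX $ k)) n \<omega> / avg (wt g) n \<omega>
              - avg (\<lambda>u. cov k u - mX $ k) n \<omega>) * c $ k)"
proof -
  have "(avg (\<lambda>u. wt g u * (cov k u - mX $ k)) n \<omega> / avg (wt g) n \<omega> - avg (\<lambda>u. cov k u - mX $ k) n \<omega>) * c $ k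
      = ((avg (\<lambda>u. wt g u * cov k u) n \<omega> - avg (wt g) n \<omega> * avg (cov k) n \<omega>) * c $ k) / avg (wt g) n \<omega>" for k
    using w by (simp add: right_diff_distrib avg_linear avg_const[OF n] diff_divide_distrib) (simp add: field_simps)
  moreover have "avg (\<lambda>u. wt g u * (out g u - \<mu> $ g)) n \<omega> / avg (wt g) n \<omega> =
      avg (\<lambda>u. wt g u * out g u) n \<omega> / avg (wt g) n \<omega> - \<mu> $ g"
    using w by (simp add: right_diff_distrib avg_linear diff_divide_distrib)
  ultimately have "avg (\<lambda>u. wt g u * (out g u - \<mu> $ g)) n \<omega> / avg (wt g) n \<omega>
        - (\<Sum>k\<in>UNIV. (avg (\<lambda>u. wt g u * (cov k u - mX $ k)) n \<omega> / avg (wt g) n \<omega>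
              - avg (\<lambda>u. cov k u - mX $ k) n \<omega>) * c $ k)
      = avg (wt g) n \<omega> * e / avg (wt g) n \<omega> - \<mu> $ g"
    unfolding e by (simp only: diff_divide_distrib sum_divide_distrib)
  then show ?thesis using w by simp
qed

lemma avg_wt_tendsto: "((\<lambda>p. avg (wt g) (fst p) (snd p)) \<longlongrightarrow> \<rho> g) (in_prob M)"
  by (rule avg_tendsto) (auto simp: integrable_Wind expectation_Wind)

lemma eventually_avg_wt: "\<forall>\<^sub>F p in in_prob M. fst p > 0 \<and> avg (wt g) (fst p) (snd p) \<noteq> 0"
proof (rule eventually_conj)
  show "\<forall>\<^sub>F p in in_prob M. fst p > 0"
    by (rule eventually_in_prob_sequentially) (auto intro: eventually_mono[OF eventually_gt_at_top[of 0]])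
  show "\<forall>\<^sub>F p in in_prob M. avg (wt g) (fst p) (snd p) \<noteq> 0"
    using tendsto_imp_eventually_ne[OF avg_wt_tendsto, of g 0] rho_pos[of g] by simp
qed

lemma Xbar_nth: "Xbar n (\<lambda>i. X i \<omega>) $ k = avg (cov k) n \<omega>"
  by (simp add: Xbar_def avg_def)

subsection \<open>Separate regression adjustment\<close>

definition sregr :: "'k option \<Rightarrow> 'g \<times> (real^'g) \<times> (real^'k) \<Rightarrow> real" where
  "sregr j u = (case j of None \<Rightarrow> 1 | Some k \<Rightarrow> cov k u)"

definition sA :: "'g \<Rightarrow> nat \<Rightarrow> 'a \<Rightarrow> real^('k option)^('k option)" where
  "sA g n \<omega> = (\<chi> a b. avg (\<lambda>u. wt g u * (sregr a u * sregr b u)) n \<omega>)"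

definition sb :: "'g \<Rightarrow> nat \<Rightarrow> 'a \<Rightarrow> real^('k option)" where
  "sb g n \<omega> = (\<chi> a. avg (\<lambda>u. wt g u * (out g u * sregr a u)) n \<omega>)"

definition scoef :: "'g \<Rightarrow> nat \<Rightarrow> 'a \<Rightarrow> real^('k option)" where
  "scoef g n \<omega> = inv0 (sA g n \<omega>) *v sb g n \<omega>"

lemma sregr_measurable [measurable]: "sregr j \<in> borel_measurable obs"
  unfolding sregr_def by (cases j) simp_all

lemma sregr_Pair: "sregr j (d, y, x) = (case j of None \<Rightarrow> 1 | Some k \<Rightarrow> x $ k)"
  by (cases j) (simp_all add: sregr_def)

lemma sregr_unit: "sregr j (unit i \<omega>) = (case j of None \<Rightarrow> 1 | Some k \<Rightarrow> X i \<omega> $ k)"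
  by (simp add: unit_def sregr_Pair)

lemma ols_eq_scoef:
  "ols {i. i < n \<and> D i \<omega> = g} (\<lambda>i. \<chi> j. case j of None \<Rightarrow> 1 | Some k \<Rightarrow> X i \<omega> $ k) (\<lambda>i. Y i \<omega> $ D i \<omega>) = scoef g n \<omega>"
proof (cases "n = 0")
  case True
  have "sb g 0 \<omega> = 0" by (simp add: sb_def avg_def vec_eq_iff)
  with True show ?thesis by (simp add: ols_def scoef_def)
next
  case False
  have W: "of_bool (D i \<omega> = g) = Wind (D i \<omega>) g"
    "Wind (D i \<omega>) g * (Y i \<omega> $ D i \<omega> * a) = Wind (D i \<omega>) g * (Y i \<omega> $ g * a)" for i a
    by (auto simp: Wind_def)
  have "1 / real n \<noteq> 0" using False by simp
  from ols_eq_inv0[OF this, of n "\<lambda>i. D i \<omega> = g" "\<lambda>i. \<chi> j. case j of None \<Rightarrow> 1 | Some k \<Rightarrow> X i \<omega> $ k"]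
  show ?thesis
    by (simp add: scoef_def sA_def sb_def avg_def sregr_unit W)
qed

lemma sra_nth:
  "sra n (\<lambda>i. D i \<omega>) (\<lambda>i. Y i \<omega>) (\<lambda>i. X i \<omega>) $ g =
    scoef g n \<omega> $ None + (\<Sum>k\<in>UNIV. avg (cov k) n \<omega> * scoef g n \<omega> $ Some k)"
  by (simp add: sra_def ols_eq_scoef Let_def Xbar_nth)

lemma scoef_measurable [measurable]: "(\<lambda>\<omega>. scoef g n \<omega> $ j) \<in> borel_measurable M"
  unfolding scoef_def by (rule borel_measurable_inv0) (simp_all add: sA_def sb_def)

lemma sra_measurable: "(\<lambda>\<omega>. sra n (\<lambda>i. D i \<omega>) (\<lambda>i. Y i \<omega>) (\<lambda>i. X i \<omega>)) \<in> borel_measurable M"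
  by (intro borel_measurable_vecI) (simp add: sra_nth)

definition sA0 :: "'g \<Rightarrow> real^('k option)^('k option)" where
  "sA0 g = (\<chi> a b. \<rho> g * (case a of
      None \<Rightarrow> (case b of None \<Rightarrow> 1 | Some l \<Rightarrow> mX $ l)
    | Some k \<Rightarrow> (case b of None \<Rightarrow> mX $ k | Some l \<Rightarrow> Sxx M (X 0) $ k $ l + mX $ k * mX $ l)))"

definition sb0 :: "'g \<Rightarrow> real^('k option)" where
  "sb0 g = (\<chi> a. \<rho> g * (case a of None \<Rightarrow> \<mu> $ g
    | Some k \<Rightarrow> (Sxx M (X 0) *v beta_g M (Y 0) (X 0) g) $ k + \<mu> $ g * mX $ k))"

lemma sA_tendsto: "((\<lambda>p. sA g (fst p) (snd p) $ a $ b) \<longlongrightarrow> sA0 g $ a $ b) (in_prob M)"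
proof -
  let ?h = "\<lambda>(y :: real^'g, x :: real^'k). sregr a (g, y, x) * sregr b (g, y, x)"
  have h: "?h \<in> borel_measurable (borel \<Otimes>\<^sub>M borel)" unfolding sregr_Pair
    by (cases a; cases b) simp_all
  have i: "integrable M (\<lambda>\<omega>. ?h (Y 0 \<omega>, X 0 \<omega>))" unfolding sregr_Pair
    using X_int XX_int by (cases a; cases b) simp_all
  have "\<rho> g * expectation (\<lambda>\<omega>. ?h (Y 0 \<omega>, X 0 \<omega>)) = sA0 g $ a $ b" unfolding sregr_Pair
    by (cases a; cases b) (simp_all add: sA0_def prob_space expectation_X Sxx_nth)
  with Wind_mult[OF h i, of g] show ?thesis
    unfolding sA_def vec_lambda_beta
    by (intro avg_tendsto) (measurable, simp_all add: sregr_Pair sregr_unit)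
qed

lemma sb_tendsto: "((\<lambda>p. sb g (fst p) (snd p) $ a) \<longlongrightarrow> sb0 g $ a) (in_prob M)"
proof -
  let ?h = "\<lambda>(y :: real^'g, x :: real^'k). y $ g * sregr a (g, y, x)"
  have h: "?h \<in> borel_measurable (borel \<Otimes>\<^sub>M borel)" unfolding sregr_Pair
    by (cases a) simp_all
  have i: "integrable M (\<lambda>\<omega>. ?h (Y 0 \<omega>, X 0 \<omega>))" unfolding sregr_Pair
    using Y_int YX_int by (cases a) simp_all
  have "\<rho> g * expectation (\<lambda>\<omega>. ?h (Y 0 \<omega>, X 0 \<omega>)) = sb0 g $ a" unfolding sregr_Pair
    by (cases a) (simp_all add: sb0_def expectation_Y Sxx_beta_g)
  with Wind_mult[OF h i, of g] show ?thesis
    unfolding sb_def vec_lambda_beta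
    by (intro avg_tendsto) (measurable, simp_all add: sregr_Pair sregr_unit)
qed

lemma sA0_mult_vec:
  fixes v :: "real^('k option)"
  defines "c \<equiv> v $ None + (\<Sum>l\<in>UNIV. mX $ l * v $ Some l)"
  shows "(sA0 g *v v) $ None = \<rho> g * c"
    and "(sA0 g *v v) $ Some k = \<rho> g * ((Sxx M (X 0) *v (\<chi> l. v $ Some l)) $ k + mX $ k * c)"
  by (simp_all add: sA0_def c_def matrix_vector_mult_def sum_UNIV_option algebra_simps sum.distrib sum_distrib_left)

lemma sA0_invertible: "invertible (sA0 g)"
  unfolding invertible_iff_ker
proof (intro allI impI)
  fix v assume v: "sA0 g *v v = 0"
  let ?v = "\<chi> l. v $ Some l"
  have \<rho>: "\<rho> g \<noteq> 0" using rho_pos[of g] by simp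
  have c: "v $ None + (\<Sum>l\<in>UNIV. mX $ l * v $ Some l) = 0"
    using sA0_mult_vec(1)[of g v] v \<rho> by simp
  have "Sxx M (X 0) *v ?v = 0"
    using sA0_mult_vec(2)[of g v] v \<rho> c by (simp add: vec_eq_iff)
  then have "?v = 0" using Sxx_invertible by (simp add: invertible_iff_ker)
  then have s: "v $ Some l = 0" for l by (simp add: vec_eq_iff)
  with c have "v $ None = 0" by simp
  with s show "v = 0" unfolding vec_eq_iff by (metis option.exhaust zero_index)
qed

lemma sA0_solution: "(inv0 (sA0 g) *v sb0 g) $ Some k = beta_g M (Y 0) (X 0) g $ k"
proof -
  let ?v = "\<chi> j. case j of None \<Rightarrow> \<mu> $ g - mX \<bullet> beta_g M (Y 0) (X 0) g | Some k \<Rightarrow> beta_g M (Y 0) (X 0) g $ k"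
  have "(sA0 g *v ?v) $ j = sb0 g $ j" for j
    by (cases j) (simp_all add: sA0_mult_vec sb0_def inner_vec_def)
  then have "inv0 (sA0 g) *v sb0 g = ?v"
    by (intro inv0_solves(2) sA0_invertible) (simp add: vec_eq_iff)
  then show ?thesis by simp
qed

lemma sra_asymptotics:
  "\<exists>L. is_mvnormal0 L (\<chi> a c. expectation (\<lambda>\<omega>. infl (beta_g M (Y 0) (X 0)) (unit 0 \<omega>) $ a
        * infl (beta_g M (Y 0) (X 0)) (unit 0 \<omega>) $ c)) \<and>
    conv_distr M (\<lambda>n \<omega>. sqrt (real n) *\<^sub>R (sra n (\<lambda>i. D i \<omega>) (\<lambda>i. Y i \<omega>) (\<lambda>i. X i \<omega>) - \<mu>)) L"
proof (rule asymptotic_normality[where bh = "\<lambda>g n \<omega>. \<chi> k. scoef g n \<omega> $ Some k"])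
  have lim: "((\<lambda>p. scoef g (fst p) (snd p) $ j) \<longlongrightarrow> (inv0 (sA0 g) *v sb0 g) $ j) (in_prob M)"
    "\<forall>\<^sub>F p in in_prob M. sA g (fst p) (snd p) *v scoef g (fst p) (snd p) = sb g (fst p) (snd p)" for g j
    unfolding scoef_def by (rule tendsto_inv0[OF sA_tendsto sb_tendsto sA0_invertible])+
  show "((\<lambda>p. (\<chi> k. scoef g (fst p) (snd p) $ Some k) $ k) \<longlongrightarrow> beta_g M (Y 0) (X 0) g $ k) (in_prob M)" for g k
    using lim(1)[of g "Some k"] by (simp add: sA0_solution)
  show "\<forall>\<^sub>F p in in_prob M. sra (fst p) (\<lambda>i. D i (snd p)) (\<lambda>i. Y i (snd p)) (\<lambda>i. X i (snd p)) $ g - \<mu> $ g =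
        avg (\<lambda>u. wt g u * (out g u - \<mu> $ g)) (fst p) (snd p) / avg (wt g) (fst p) (snd p)
        - (\<Sum>k\<in>UNIV. (avg (\<lambda>u. wt g u * (cov k u - mX $ k)) (fst p) (snd p) / avg (wt g) (fst p) (snd p)
              - avg (\<lambda>u. cov k u - mX $ k) (fst p) (snd p)) * (\<chi> k. scoef g (fst p) (snd p) $ Some k) $ k)" for g
    using lim(2)[of g] eventually_avg_wt[of g]
  proof eventually_elim
    case (elim p)
    have "(sA g (fst p) (snd p) *v scoef g (fst p) (snd p)) $ None = sb g (fst p) (snd p) $ None"
      using elim by simp
    then have "avg (wt g) (fst p) (snd p) * scoef g (fst p) (snd p) $ None
        + (\<Sum>k\<in>UNIV. avg (\<lambda>u. wt g u * cov k u) (fst p) (snd p) * scoef g (fst p) (snd p) $ Some k)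
        = avg (\<lambda>u. wt g u * out g u) (fst p) (snd p)"
      by (simp add: matrix_vector_mult_def sum_UNIV_option sA_def sb_def sregr_def)
    then show ?case
      using elim by (intro adjusted_mean_centered)
        (auto simp: sra_nth algebra_simps sum_distrib_left sum.distrib sum_subtractf)
  qed
qed (rule sra_measurable)

subsection \<open>Pooled regression adjustment\<close>

abbreviation yobs :: "'g \<times> (real^'g) \<times> (real^'k) \<Rightarrow> real" where
  "yobs u \<equiv> \<Sum>g\<in>UNIV. wt g u * out g u"

definition pA :: "nat \<Rightarrow> 'a \<Rightarrow> real^('g + 'k)^('g + 'k)" where
  "pA n \<omega> = (\<chi> a b. case a of
      Inl g \<Rightarrow> (case b of Inl h \<Rightarrow> of_bool (g = h) * avg (wt g) n \<omega>
        | Inr l \<Rightarrow> avg (\<lambda>u. wt g u * cov l u) n \<omega> - avg (wt g) n \<omega> * avg (cov l) n \<omega>)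
    | Inr k \<Rightarrow> (case b of Inl h \<Rightarrow> avg (\<lambda>u. wt h u * cov k u) n \<omega> - avg (wt h) n \<omega> * avg (cov k) n \<omega>
        | Inr l \<Rightarrow> avg (\<lambda>u. cov k u * cov l u) n \<omega> - avg (cov k) n \<omega> * avg (cov l) n \<omega>))"

definition pb :: "nat \<Rightarrow> 'a \<Rightarrow> real^('g + 'k)" where
  "pb n \<omega> = (\<chi> a. case a of Inl g \<Rightarrow> avg (\<lambda>u. wt g u * out g u) n \<omega>
    | Inr k \<Rightarrow> avg (\<lambda>u. yobs u * cov k u) n \<omega> - avg yobs n \<omega> * avg (cov k) n \<omega>)"

definition pcoef :: "nat \<Rightarrow> 'a \<Rightarrow> real^('g + 'k)" where
  "pcoef n \<omega> = inv0 (pA n \<omega>) *v pb n \<omega>"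

lemma yobs_unit: "yobs (unit i \<omega>) = Y i \<omega> $ D i \<omega>"
  by (simp add: Wind_def if_distrib[of "\<lambda>x. x * _"] cong: if_cong)

lemma avg_centered:
  assumes n: "n > 0"
  shows "(\<Sum>i<n. f (unit i \<omega>) * (X i \<omega> $ k - avg (cov k) n \<omega>)) / real n
    = avg (\<lambda>u. f u * cov k u) n \<omega> - avg f n \<omega> * avg (cov k) n \<omega>"
  by (simp add: right_diff_distrib sum_subtractf diff_divide_distrib avg_def[of "\<lambda>u. f u * cov k u"] avg_def[of f]
      flip: sum_distrib_right)

lemma ols_eq_pcoef:
  assumes n: "n > 0"
  shows "ols {..<n} (\<lambda>i. \<chi> j. case j of Inl h \<Rightarrow> Wind (D i \<omega>) h | Inr k \<Rightarrow> X i \<omega> $ k - Xbar n (\<lambda>i. X i \<omega>) $ k)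
      (\<lambda>i. Y i \<omega> $ D i \<omega>) = pcoef n \<omega>"
proof -
  let ?r = "\<lambda>i. (\<chi> j. case j of Inl h \<Rightarrow> Wind (D i \<omega>) h | Inr k \<Rightarrow> X i \<omega> $ k - avg (cov k) n \<omega>) :: real^('g + 'k)"
  have c: "1 / real n \<noteq> 0" using n by simp
  have avg0: "(\<Sum>i<n. X i \<omega> $ k - avg (cov k) n \<omega>) = 0" for k
    using n by (simp add: sum_subtractf avg_def)
  have "(\<chi> a b. 1 / real n * (\<Sum>i<n. of_bool True * (?r i $ a * ?r i $ b))) = pA n \<omega>"
  proof -
    have "(\<Sum>i<n. ?r i $ a * ?r i $ b) / real n = pA n \<omega> $ a $ b" for a b
    proof (cases a; cases b)
      fix g h assume "a = Inl g" "b = Inl h"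
      then show ?thesis
        using n by (auto simp: pA_def avg_def Wind_def intro!: arg_cong[where f="\<lambda>x. x / real n"] sum.cong sum.neutral)
    next
      fix g l assume "a = Inl g" "b = Inr l"
      then show ?thesis using avg_centered[OF n, of "wt g" \<omega> l] by (simp add: pA_def)
    next
      fix h k assume "a = Inr k" "b = Inl h"
      then show ?thesis using avg_centered[OF n, of "wt h" \<omega> k] by (simp add: pA_def mult.commute)
    next
      fix k l assume ab: "a = Inr k" "b = Inr l"
      have "(\<Sum>i<n. (X i \<omega> $ k - avg (cov k) n \<omega>) * (X i \<omega> $ l - avg (cov l) n \<omega>))
         = (\<Sum>i<n. X i \<omega> $ k * (X i \<omega> $ l - avg (cov l) n \<omega>)) - avg (cov k) n \<omega> * (\<Sum>i<n. X i \<omega> $ l - avg (cov l) n \<omega>)"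
        by (simp only: sum_distrib_left flip: sum_subtractf left_diff_distrib)
      then show ?thesis using avg_centered[OF n, of "cov k" \<omega> l] ab by (simp add: pA_def avg0)
    qed
    then show ?thesis by (simp add: vec_eq_iff)
  qed
  moreover have "(\<chi> a. 1 / real n * (\<Sum>i<n. of_bool True * (Y i \<omega> $ D i \<omega> * ?r i $ a))) = pb n \<omega>"
  proof -
    have "(\<Sum>i<n. Y i \<omega> $ D i \<omega> * ?r i $ a) / real n = pb n \<omega> $ a" for a
    proof (cases a)
      case (Inl g)
      have "Y i \<omega> $ D i \<omega> * Wind (D i \<omega>) g = Wind (D i \<omega>) g * Y i \<omega> $ g" for i by (simp add: Wind_def)
      note e = this
      from Inl show ?thesis by (simp add: pb_def avg_def e)
    next
      case (Inr k)
      then show ?thesis using avg_centered[OF n, of yobs \<omega> k] unfolding yobs_unit by (simp add: pb_def)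
    qed
    then show ?thesis by (simp add: vec_eq_iff)
  qed
  moreover have "{i. i < n \<and> True} = {..<n}" by auto
  ultimately show ?thesis
    using ols_eq_inv0[OF c, of n "\<lambda>_. True" ?r "\<lambda>i. Y i \<omega> $ D i \<omega>"]
    by (simp only: pcoef_def Xbar_nth)
qed

lemma pra_nth: "n > 0 \<Longrightarrow> pra n (\<lambda>i. D i \<omega>) (\<lambda>i. Y i \<omega>) (\<lambda>i. X i \<omega>) $ g = pcoef n \<omega> $ Inl g"
  by (simp only: pra_def vec_lambda_beta ols_eq_pcoef)

lemma pra_measurable: "(\<lambda>\<omega>. pra n (\<lambda>i. D i \<omega>) (\<lambda>i. Y i \<omega>) (\<lambda>i. X i \<omega>)) \<in> borel_measurable M"
proof (cases "n = 0")
  case True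
  then show ?thesis by (simp add: pra_def ols_def)
next
  case False
  have "(\<lambda>\<omega>. pA n \<omega> $ a $ b) \<in> borel_measurable M" for a b
    by (cases a; cases b) (simp_all add: pA_def)
  moreover have "(\<lambda>\<omega>. pb n \<omega> $ a) \<in> borel_measurable M" for a
    by (cases a) (simp_all add: pb_def)
  ultimately have "(\<lambda>\<omega>. pcoef n \<omega> $ j) \<in> borel_measurable M" for j
    unfolding pcoef_def by (rule borel_measurable_inv0)
  with False show ?thesis by (intro borel_measurable_vecI) (simp add: pra_nth)
qed

definition pA0 :: "real^('g + 'k)^('g + 'k)" where
  "pA0 = (\<chi> a b. case a of
      Inl g \<Rightarrow> (case b of Inl h \<Rightarrow> of_bool (g = h) * \<rho> g | Inr l \<Rightarrow> 0)
    | Inr k \<Rightarrow> (case b of Inl h \<Rightarrow> 0 | Inr l \<Rightarrow> Sxx M (X 0) $ k $ l))"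

definition pb0 :: "real^('g + 'k)" where
  "pb0 = (\<chi> a. case a of Inl g \<Rightarrow> \<rho> g * \<mu> $ g | Inr k \<Rightarrow> (Sxx M (X 0) *v beta_obs M (D 0) (Y 0) (X 0)) $ k)"

lemma avg_cov_tendsto: "((\<lambda>p. avg (cov k) (fst p) (snd p)) \<longlongrightarrow> mX $ k) (in_prob M)"
  by (rule avg_tendsto) (simp_all add: X_int expectation_X)

lemma avg_wt_cov_tendsto: "((\<lambda>p. avg (\<lambda>u. wt g u * cov k u) (fst p) (snd p)) \<longlongrightarrow> \<rho> g * mX $ k) (in_prob M)"
  using Wind_mult[of "\<lambda>(y, x). x $ k" g] X_int[of k] expectation_X[of k]
  by (intro avg_tendsto) simp_all

lemma pA_tendsto: "((\<lambda>p. pA (fst p) (snd p) $ a $ b) \<longlongrightarrow> pA0 $ a $ b) (in_prob M)"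
proof (cases a; cases b)
  fix g h assume "a = Inl g" "b = Inl h"
  then show ?thesis by (cases "g = h") (simp_all add: pA_def pA0_def avg_wt_tendsto)
next
  fix g l assume "a = Inl g" "b = Inr l"
  then show ?thesis
    using tendsto_diff[OF avg_wt_cov_tendsto tendsto_mult[OF avg_wt_tendsto avg_cov_tendsto], of g l g l]
    by (simp add: pA_def pA0_def)
next
  fix h k assume "a = Inr k" "b = Inl h"
  then show ?thesis
    using tendsto_diff[OF avg_wt_cov_tendsto tendsto_mult[OF avg_wt_tendsto avg_cov_tendsto], of h k h k]
    by (simp add: pA_def pA0_def)
next
  fix k l assume ab: "a = Inr k" "b = Inr l"
  have "((\<lambda>p. avg (\<lambda>u. cov k u * cov l u) (fst p) (snd p)) \<longlongrightarrow> expectation (\<lambda>\<omega>. X 0 \<omega> $ k * X 0 \<omega> $ l)) (in_prob M)"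
    by (rule avg_tendsto) (simp_all add: XX_int)
  from tendsto_diff[OF this tendsto_mult[OF avg_cov_tendsto avg_cov_tendsto], of k l]
  show ?thesis using ab by (simp add: pA_def pA0_def Sxx_nth)
qed

lemma pb_tendsto: "((\<lambda>p. pb (fst p) (snd p) $ a) \<longlongrightarrow> pb0 $ a) (in_prob M)"
proof (cases a)
  case (Inl g)
  have "((\<lambda>p. avg (\<lambda>u. wt g u * out g u) (fst p) (snd p)) \<longlongrightarrow> \<rho> g * \<mu> $ g) (in_prob M)"
    using Wind_mult[of "\<lambda>(y, x). y $ g" g] Y_int[of g] expectation_Y[of g]
    by (intro avg_tendsto) simp_all
  with Inl show ?thesis by (simp add: pb_def pb0_def)
next
  case (Inr k)
  have 1: "((\<lambda>p. avg yobs (fst p) (snd p)) \<longlongrightarrow> expectation (\<lambda>\<omega>. Y 0 \<omega> $ D 0 \<omega>)) (in_prob M)"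
    by (rule avg_tendsto) (simp_all add: yobs_unit obs_int del: unit_sel)
  have 2: "((\<lambda>p. avg (\<lambda>u. yobs u * cov k u) (fst p) (snd p)) \<longlongrightarrow> expectation (\<lambda>\<omega>. Y 0 \<omega> $ D 0 \<omega> * X 0 \<omega> $ k)) (in_prob M)"
    by (rule avg_tendsto) (simp_all only: yobs_unit unit_sel(3) obs_int, measurable)
  from tendsto_diff[OF 2 tendsto_mult[OF 1 avg_cov_tendsto]] Inr
  show ?thesis by (simp add: pb_def pb0_def Sxx_beta_obs)
qed

lemma pA0_mult_vec:
  "(pA0 *v v) $ Inl g = \<rho> g * v $ Inl g"
  "(pA0 *v v) $ Inr k = (Sxx M (X 0) *v (\<chi> l. v $ Inr l)) $ k"
  by (simp_all add: pA0_def matrix_vector_mult_def sum_UNIV_sum of_bool_def if_distrib[of "\<lambda>x. x * _"] cong: if_cong)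

lemma pA0_invertible: "invertible pA0"
  unfolding invertible_iff_ker
proof (intro allI impI)
  fix v assume v: "pA0 *v v = 0"
  have 1: "v $ Inl g = 0" for g
    using pA0_mult_vec(1)[of v g] v rho_pos[of g] by simp
  have "Sxx M (X 0) *v (\<chi> l. v $ Inr l) = 0"
    using pA0_mult_vec(2)[of v] v by (simp add: vec_eq_iff)
  then have "(\<chi> l. v $ Inr l) = 0" using Sxx_invertible by (simp add: invertible_iff_ker)
  then have 2: "v $ Inr l = 0" for l by (simp add: vec_eq_iff)
  from 1 2 show "v = 0" unfolding vec_eq_iff by (metis sum.exhaust zero_index)
qed

lemma pA0_solution: "(inv0 pA0 *v pb0) $ Inr k = beta_obs M (D 0) (Y 0) (X 0) $ k"
proof -
  let ?v = "\<chi> j. case j of Inl g \<Rightarrow> \<mu> $ g | Inr k \<Rightarrow> beta_obs M (D 0) (Y 0) (X 0) $ k"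
  have "(pA0 *v ?v) $ j = pb0 $ j" for j
    by (cases j) (simp_all add: pA0_mult_vec pb0_def)
  then have "inv0 pA0 *v pb0 = ?v"
    by (intro inv0_solves(2) pA0_invertible) (simp add: vec_eq_iff)
  then show ?thesis by simp
qed

lemma pra_asymptotics:
  "\<exists>L. is_mvnormal0 L (\<chi> a c. expectation (\<lambda>\<omega>. infl (\<lambda>_. beta_obs M (D 0) (Y 0) (X 0)) (unit 0 \<omega>) $ a
        * infl (\<lambda>_. beta_obs M (D 0) (Y 0) (X 0)) (unit 0 \<omega>) $ c)) \<and>
    conv_distr M (\<lambda>n \<omega>. sqrt (real n) *\<^sub>R (pra n (\<lambda>i. D i \<omega>) (\<lambda>i. Y i \<omega>) (\<lambda>i. X i \<omega>) - \<mu>)) L"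
proof (rule asymptotic_normality[where bh = "\<lambda>g n \<omega>. \<chi> k. pcoef n \<omega> $ Inr k"])
  note lim = tendsto_inv0[where F = "in_prob M", OF pA_tendsto pb_tendsto pA0_invertible, folded pcoef_def]
  show "((\<lambda>p. (\<chi> k. pcoef (fst p) (snd p) $ Inr k) $ k) \<longlongrightarrow> beta_obs M (D 0) (Y 0) (X 0) $ k) (in_prob M)" for k
    using lim(1)[of "Inr k"] by (simp add: pA0_solution)
  show "\<forall>\<^sub>F p in in_prob M. pra (fst p) (\<lambda>i. D i (snd p)) (\<lambda>i. Y i (snd p)) (\<lambda>i. X i (snd p)) $ g - \<mu> $ g =
        avg (\<lambda>u. wt g u * (out g u - \<mu> $ g)) (fst p) (snd p) / avg (wt g) (fst p) (snd p)
        - (\<Sum>k\<in>UNIV. (avg (\<lambda>u. wt g u * (cov k u - mX $ k)) (fst p) (snd p) / avg (wt g) (fst p) (snd p)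
              - avg (\<lambda>u. cov k u - mX $ k) (fst p) (snd p)) * (\<chi> k. pcoef (fst p) (snd p) $ Inr k) $ k)" for g
    using lim(2) eventually_avg_wt[of g]
  proof eventually_elim
    case (elim p)
    have "(pA (fst p) (snd p) *v pcoef (fst p) (snd p)) $ Inl g = pb (fst p) (snd p) $ Inl g"
      using elim by simp
    then have "avg (wt g) (fst p) (snd p) * pcoef (fst p) (snd p) $ Inl g
        + (\<Sum>k\<in>UNIV. (avg (\<lambda>u. wt g u * cov k u) (fst p) (snd p) - avg (wt g) (fst p) (snd p) * avg (cov k) (fst p) (snd p))
            * pcoef (fst p) (snd p) $ Inr k)
        = avg (\<lambda>u. wt g u * out g u) (fst p) (snd p)"
      by (simp add: matrix_vector_mult_def sum_UNIV_sum pA_def pb_def of_bool_def if_distrib[of "\<lambda>x. x * _"] cong: if_cong)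
    then show ?case
      using elim by (intro adjusted_mean_centered) (simp_all add: pra_nth)
  qed
qed (rule pra_measurable)

subsection \<open>The covariance gap\<close>

lemma expectation_resid_orthogonal:
  "expectation (\<lambda>\<omega>. (Y 0 \<omega> $ g - \<mu> $ g - (X 0 \<omega> - mX) \<bullet> beta_g M (Y 0) (X 0) g) * ((X 0 \<omega> - mX) \<bullet> v)) = 0"
proof -
  let ?b = "beta_g M (Y 0) (X 0) g"
  have qint: "integrable M (\<lambda>\<omega>. ((X 0 \<omega> - mX) \<bullet> ?b) * (X 0 \<omega> $ k - mX $ k))" for k
    using inner_Xc_sq[of ?b] inner_Xc_sq[of "axis k 1"]
    by (intro square_integrable_mult) (simp_all add: inner_axis)
  have pint: "integrable M (\<lambda>\<omega>. (Y 0 \<omega> $ g - \<mu> $ g) * (X 0 \<omega> $ k - mX $ k))" for k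
    using X_int Y_int YX_int by (simp add: algebra_simps)
  have q: "expectation (\<lambda>\<omega>. ((X 0 \<omega> - mX) \<bullet> ?b) * (X 0 \<omega> $ k - mX $ k)) = (Sxx M (X 0) *v ?b) $ k" for k
  proof -
    have i: "integrable M (\<lambda>\<omega>. (X 0 \<omega> $ k - mX $ k) * (X 0 \<omega> $ l - mX $ l))" for l
      using X_int XX_int by (simp add: algebra_simps)
    have S: "expectation (\<lambda>\<omega>. (X 0 \<omega> $ k - mX $ k) * (X 0 \<omega> $ l - mX $ l)) = Sxx M (X 0) $ k $ l" for l
      unfolding Sxx_nth using X_int XX_int by (simp add: algebra_simps prob_space expectation_X)
    have "expectation (\<lambda>\<omega>. ((X 0 \<omega> - mX) \<bullet> ?b) * (X 0 \<omega> $ k - mX $ k)) =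
      expectation (\<lambda>\<omega>. \<Sum>l\<in>UNIV. ((X 0 \<omega> $ k - mX $ k) * (X 0 \<omega> $ l - mX $ l)) * ?b $ l)"
      by (simp add: inner_vec_def sum_distrib_left mult_ac)
    also have "\<dots> = (\<Sum>l\<in>UNIV. expectation (\<lambda>\<omega>. (X 0 \<omega> $ k - mX $ k) * (X 0 \<omega> $ l - mX $ l)) * ?b $ l)"
      using i by simp
    finally show ?thesis by (simp add: matrix_vector_mult_def S)
  qed
  have p: "expectation (\<lambda>\<omega>. (Y 0 \<omega> $ g - \<mu> $ g) * (X 0 \<omega> $ k - mX $ k)) = (Sxx M (X 0) *v ?b) $ k" for k
    unfolding Sxx_beta_g using X_int Y_int YX_int
    by (simp add: algebra_simps prob_space expectation_X expectation_Y)
  have "(Y 0 \<omega> $ g - \<mu> $ g - (X 0 \<omega> - mX) \<bullet> ?b) * ((X 0 \<omega> - mX) \<bullet> v) =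
      (\<Sum>k\<in>UNIV. ((Y 0 \<omega> $ g - \<mu> $ g) * (X 0 \<omega> $ k - mX $ k)
        - ((X 0 \<omega> - mX) \<bullet> ?b) * (X 0 \<omega> $ k - mX $ k)) * v $ k)" for \<omega>
    unfolding left_diff_distrib[symmetric] by (simp add: inner_vec_def[of _ v] sum_distrib_left mult.assoc)
  then show ?thesis using pint qint p q by simp
qed

abbreviation "inflS \<omega> \<equiv> infl (beta_g M (Y 0) (X 0)) (unit 0 \<omega>)"
abbreviation "inflP \<omega> \<equiv> infl (\<lambda>_. beta_obs M (D 0) (Y 0) (X 0)) (unit 0 \<omega>)"
abbreviation "F \<omega> \<equiv> Fvec M (D 0) (Y 0) (X 0) \<omega>"

lemma inflP_eq: "inflP \<omega> $ g = inflS \<omega> $ g + F \<omega> $ g"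
  using rho_pos[of g]
  by (simp add: infl_def Fvec_def delta_def Xdot_def inner_diff_right field_simps)

lemma infl_mult_int: "integrable M (\<lambda>\<omega>. infl b (unit 0 \<omega>) $ a * infl b' (unit 0 \<omega>) $ c)"
  by (intro square_integrable_mult infl_sq) measurable

lemma F_int:
  "integrable M (\<lambda>\<omega>. inflS \<omega> $ a * F \<omega> $ c)" "integrable M (\<lambda>\<omega>. F \<omega> $ a * F \<omega> $ c)"
proof -
  have "F \<omega> $ a = inflP \<omega> $ a - inflS \<omega> $ a" for \<omega> a by (simp add: inflP_eq)
  note F_diff = this
  show "integrable M (\<lambda>\<omega>. inflS \<omega> $ a * F \<omega> $ c)" "integrable M (\<lambda>\<omega>. F \<omega> $ a * F \<omega> $ c)"
    unfolding F_diff using infl_mult_int by (simp_all add: algebra_simps)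
qed

lemma expectation_inflS_F: "expectation (\<lambda>\<omega>. inflS \<omega> $ a * F \<omega> $ c) = 0"
proof -
  let ?ba = "beta_g M (Y 0) (X 0) a" and ?d = "delta M (D 0) (Y 0) (X 0) c"
  let ?ed = "\<lambda>(y, x). (y $ a - \<mu> $ a - (x - mX) \<bullet> ?ba) * ((x - mX) \<bullet> ?d)"
  let ?qd = "\<lambda>(y :: real^'g, x). ((x - mX) \<bullet> ?ba) * ((x - mX) \<bullet> ?d)"
  let ?Z = "\<lambda>\<omega>. (Y 0 \<omega>, X 0 \<omega>)"
  have ed: "integrable M (\<lambda>\<omega>. ?ed (?Z \<omega>))" "expectation (\<lambda>\<omega>. ?ed (?Z \<omega>)) = 0"
    using resid_sq[of a ?ba] inner_Xc_sq[of ?d] expectation_resid_orthogonal[of a ?d]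
    by (auto intro!: square_integrable_mult)
  have qd: "integrable M (\<lambda>\<omega>. ?qd (?Z \<omega>))"
    using inner_Xc_sq by (auto intro!: square_integrable_mult)
  have Wed: "integrable M (\<lambda>\<omega>. Wind (D 0 \<omega>) a * ?ed (?Z \<omega>))" "expectation (\<lambda>\<omega>. Wind (D 0 \<omega>) a * ?ed (?Z \<omega>)) = 0"
    using Wind_mult[of ?ed a] ed by simp_all
  have Wqd: "integrable M (\<lambda>\<omega>. Wind (D 0 \<omega>) c * ?qd (?Z \<omega>))"
    "expectation (\<lambda>\<omega>. Wind (D 0 \<omega>) c * ?qd (?Z \<omega>)) = \<rho> c * expectation (\<lambda>\<omega>. ?qd (?Z \<omega>))"
    using Wind_mult[of ?qd c] qd by simp_all
  have \<rho>: "\<rho> a \<noteq> 0" "\<rho> c \<noteq> 0" using rho_pos by (simp_all add: less_imp_neq[symmetric])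
  have "inflS \<omega> $ a * F \<omega> $ c = (of_bool (a = c) / (\<rho> a * \<rho> c) - 1 / \<rho> a) * (Wind (D 0 \<omega>) a * ?ed (?Z \<omega>))
      + (Wind (D 0 \<omega>) c * ?qd (?Z \<omega>)) / \<rho> c - ?qd (?Z \<omega>)" for \<omega>
    using \<rho> by (cases "D 0 \<omega> = a"; cases "D 0 \<omega> = c")
      (auto simp: infl_def Fvec_def Xdot_def Wind_def field_simps)
  then have "expectation (\<lambda>\<omega>. inflS \<omega> $ a * F \<omega> $ c) =
      (of_bool (a = c) / (\<rho> a * \<rho> c) - 1 / \<rho> a) * expectation (\<lambda>\<omega>. Wind (D 0 \<omega>) a * ?ed (?Z \<omega>))
      + expectation (\<lambda>\<omega>. Wind (D 0 \<omega>) c * ?qd (?Z \<omega>)) / \<rho> c - expectation (\<lambda>\<omega>. ?qd (?Z \<omega>))"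
    using Wed(1) Wqd(1) qd by simp
  then show ?thesis unfolding Wed(2) Wqd(2) using \<rho> by simp
qed

lemma OmegaF_nth: "OmegaF M (D 0) (Y 0) (X 0) $ a $ c = expectation (\<lambda>\<omega>. F \<omega> $ a * F \<omega> $ c)"
  unfolding OmegaF_def using F_int(2) by (simp add: integral_vec)

lemma psd_OmegaF: "psd (OmegaF M (D 0) (Y 0) (X 0))"
  unfolding psd_def
proof
  fix v
  have "v \<bullet> (OmegaF M (D 0) (Y 0) (X 0) *v v)
      = (\<Sum>a\<in>UNIV. \<Sum>c\<in>UNIV. v $ a * v $ c * expectation (\<lambda>\<omega>. F \<omega> $ a * F \<omega> $ c))"
    by (simp add: inner_vec_def matrix_vector_mult_def sum_distrib_left mult_ac OmegaF_nth)
  also have "\<dots> = expectation (\<lambda>\<omega>. \<Sum>a\<in>UNIV. \<Sum>c\<in>UNIV. v $ a * v $ c * (F \<omega> $ a * F \<omega> $ c))"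
    using F_int(2) by simp
  also have "\<dots> = expectation (\<lambda>\<omega>. (\<Sum>a\<in>UNIV. v $ a * F \<omega> $ a)\<^sup>2)"
    by (simp add: power2_eq_square sum_product mult_ac)
  finally show "0 \<le> v \<bullet> (OmegaF M (D 0) (Y 0) (X 0) *v v)" by simp
qed

lemma covariance_gap:
  "(\<chi> a c. expectation (\<lambda>\<omega>. inflP \<omega> $ a * inflP \<omega> $ c)) - (\<chi> a c. expectation (\<lambda>\<omega>. inflS \<omega> $ a * inflS \<omega> $ c))
    = OmegaF M (D 0) (Y 0) (X 0)"
proof -
  have "expectation (\<lambda>\<omega>. inflP \<omega> $ a * inflP \<omega> $ c) =
      expectation (\<lambda>\<omega>. inflS \<omega> $ a * inflS \<omega> $ c) + expectation (\<lambda>\<omega>. F \<omega> $ a * F \<omega> $ c)" for a c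
  proof -
    have "inflP \<omega> $ a * inflP \<omega> $ c = inflS \<omega> $ a * inflS \<omega> $ c
        + (inflS \<omega> $ a * F \<omega> $ c + inflS \<omega> $ c * F \<omega> $ a) + F \<omega> $ a * F \<omega> $ c" for \<omega>
      by (simp add: inflP_eq algebra_simps)
    then show ?thesis using F_int infl_mult_int by (simp add: expectation_inflS_F)
  qed
  then show ?thesis by (simp add: vec_eq_iff OmegaF_nth)
qed

end

theorem theorem5:
  fixes M :: "'a measure"
    and D :: "nat \<Rightarrow> 'a \<Rightarrow> 'g::finite"
    and Y :: "nat \<Rightarrow> 'a \<Rightarrow> real^'g"
    and X :: "nat \<Rightarrow> 'a \<Rightarrow> real^'k::finite"
  assumes "prob_space M"
    and "CARD('g) \<ge> 2"
    and "\<And>i. D i \<in> M \<rightarrow>\<^sub>M count_space UNIV"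
    and "\<And>i. Y i \<in> borel_measurable M"
    and "\<And>i. X i \<in> borel_measurable M"
    and "prob_space.indep_vars M (\<lambda>_. count_space UNIV \<Otimes>\<^sub>M borel \<Otimes>\<^sub>M borel)
           (\<lambda>i \<omega>. (D i \<omega>, Y i \<omega>, X i \<omega>)) UNIV"
    and "\<And>i. distr M (count_space UNIV \<Otimes>\<^sub>M borel \<Otimes>\<^sub>M borel) (\<lambda>\<omega>. (D i \<omega>, Y i \<omega>, X i \<omega>))
            = distr M (count_space UNIV \<Otimes>\<^sub>M borel \<Otimes>\<^sub>M borel) (\<lambda>\<omega>. (D 0 \<omega>, Y 0 \<omega>, X 0 \<omega>))"
    and "\<And>A B. B \<in> sets (borel \<Otimes>\<^sub>M borel) \<Longrightarrow>
           measure M {\<omega>\<in>space M. D 0 \<omega> \<in> A \<and> (Y 0 \<omega>, X 0 \<omega>) \<in> B}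
           = measure M {\<omega>\<in>space M. D 0 \<omega> \<in> A} * measure M {\<omega>\<in>space M. (Y 0 \<omega>, X 0 \<omega>) \<in> B}"
    and "\<And>g. rho M (D 0) g > 0"
    and "\<And>g. integrable M (\<lambda>\<omega>. (Y 0 \<omega> $ g)\<^sup>2)"
    and "\<And>k. integrable M (\<lambda>\<omega>. (X 0 \<omega> $ k)\<^sup>2)"
    and "invertible (Sxx M (X 0))"
  shows "\<exists>Vp Vs.
     (\<exists>L. is_mvnormal0 L Vp \<and>
        conv_distr M (\<lambda>n \<omega>. sqrt (real n) *\<^sub>R
           (pra n (\<lambda>i. D i \<omega>) (\<lambda>i. Y i \<omega>) (\<lambda>i. X i \<omega>) - mu M (Y 0))) L) \<and>
     (\<exists>L. is_mvnormal0 L Vs \<and>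
        conv_distr M (\<lambda>n \<omega>. sqrt (real n) *\<^sub>R
           (sra n (\<lambda>i. D i \<omega>) (\<lambda>i. Y i \<omega>) (\<lambda>i. X i \<omega>) - mu M (Y 0))) L) \<and>
     Vp - Vs = OmegaF M (D 0) (Y 0) (X 0) \<and> psd (OmegaF M (D 0) (Y 0) (X 0))"
proof -
  interpret prob_space M by fact
  interpret randomized_experiment M D Y X by unfold_locales (use assms in auto)
  show ?thesis
    using pra_asymptotics sra_asymptotics covariance_gap psd_OmegaF by blast
qed

end
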